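(* Let $\overline{S}_0,\overline{S}_1,\dots$ be a sequence of bounded martingales on $2^{<\omega}$ (with no effectivity assumption) such that $\lim_{n\to\infty}\overline{S}_n(\bot)=0$, and let $T\subseteq 2^{<\omega}$ be a homogeneous tree that has no computable infinite path. Then there exists a martingale $S$ such that $S\ge\overline{S}_n$ (pointwise on $2^{<\omega}$) for infinitely many $n$, and $S$ does not compute an infinite path through $T$.
   Context: A martingale on $2^{<\omega}$ is a function $S:2^{<\omega}\to\mathbb{R}^{\ge 0}$ with $2S(\rho)=S(\rho0)+S(\rho1)$ for all $\rho$; $\bot$ is the empty string. A function is bounded if its range is a bounded subset of $\mathbb{R}$. A tree $T\subseteq 2^{<\omega}$ is homogeneous if there are sets $B_0,B_1,\dots\subseteq\{0,1\}$ such that $\rho\in T$ iff $\rho(n)\in B_n$ for all $n<|\rho|$. Computation from a martingale $S$ is via an oracle coding, for every $\rho$, a representation of the real $S(\rho)$ (e.g. an integer part together with an infinite binary expansion). *)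

theory Defs
  imports Complex_Main "HOL-Library.Nat_Bijection"
begin

definition martingale :: "(bool list \<Rightarrow> real) \<Rightarrow> bool" where
  "martingale S \<longleftrightarrow>
     (\<forall>\<rho>. S \<rho> \<ge> 0) \<and> (\<forall>\<rho>. 2 * S \<rho> = S (\<rho> @ [False]) + S (\<rho> @ [True]))"

definition bounded_fun :: "(bool list \<Rightarrow> real) \<Rightarrow> bool" where
  "bounded_fun S \<longleftrightarrow> (\<exists>B. \<forall>\<rho>. \<bar>S \<rho>\<bar> \<le> B)"

definition homogeneous_tree :: "bool list set \<Rightarrow> bool" where
  "homogeneous_tree T \<longleftrightarrow>
     (\<exists>B :: nat \<Rightarrow> bool set. \<forall>\<rho>. \<rho> \<in> T \<longleftrightarrow> (\<forall>n < length \<rho>. \<rho> ! n \<in> B n))"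

definition is_path :: "bool list set \<Rightarrow> (nat \<Rightarrow> bool) \<Rightarrow> bool" where
  "is_path T f \<longleftrightarrow> (\<forall>n. map f [0..<n] \<in> T)"

datatype recf =
    Zero
  | Succ
  | Proj nat
  | Comp recf "recf list"
  | Prec recf recf
  | Minim recf
  | Orc

inductive eval :: "(nat \<Rightarrow> nat) \<Rightarrow> recf \<Rightarrow> nat list \<Rightarrow> nat \<Rightarrow> bool" for A where
  eval_zero: "eval A Zero xs 0"
| eval_succ: "eval A Succ (x # xs) (Suc x)"
| eval_proj: "i < length xs \<Longrightarrow> eval A (Proj i) xs (xs ! i)"
| eval_comp: "list_all2 (\<lambda>g y. eval A g xs y) gs ys \<Longrightarrow> eval A f ys y \<Longrightarrow> eval A (Comp f gs) xs y"
| eval_prec0: "eval A f xs y \<Longrightarrow> eval A (Prec f g) (0 # xs) y"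
| eval_precS: "eval A (Prec f g) (n # xs) r \<Longrightarrow> eval A g (n # r # xs) y
                 \<Longrightarrow> eval A (Prec f g) (Suc n # xs) y"
| eval_minim: "eval A f (y # xs) 0 \<Longrightarrow> (\<forall>z < y. \<exists>v. v > 0 \<and> eval A f (z # xs) v)
                 \<Longrightarrow> eval A (Minim f) xs y"
| eval_orc: "eval A Orc (x # xs) (A x)"

definition computable_in :: "(nat \<Rightarrow> nat) \<Rightarrow> (nat \<Rightarrow> bool) \<Rightarrow> bool" where
  "computable_in A f \<longleftrightarrow> (\<exists>e. \<forall>n. eval A e [n] (if f n then 1 else 0))"

definition computable :: "(nat \<Rightarrow> bool) \<Rightarrow> bool" where
  "computable f \<longleftrightarrow> computable_in (\<lambda>_. 0) f"

definition string_code :: "bool list \<Rightarrow> nat" where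
  "string_code \<rho> = list_encode (map (\<lambda>b. if b then 1 else 0) \<rho>)"

text \<open>On input prod_encode (c, k), with c coding the string rho (c = string_code rho):
  k = 0 gives the integer part of S(rho); k \<ge> 1 gives the k-th digit of the standard binary
  expansion (the one not ending in all ones) of the fractional part of S(rho).\<close>
definition mart_oracle :: "(bool list \<Rightarrow> real) \<Rightarrow> nat \<Rightarrow> nat" where
  "mart_oracle S m =
     (case prod_decode m of (c, k) \<Rightarrow>
        (let \<rho> = map (\<lambda>x. x \<noteq> 0) (list_decode c) in
         if k = 0 then nat \<lfloor>S \<rho>\<rfloor> else nat (\<lfloor>2 ^ k * S \<rho>\<rfloor> mod 2)))"

definition computes_path :: "(bool list \<Rightarrow> real) \<Rightarrow> bool list set \<Rightarrow> bool" where
  "computes_path S T \<longleftrightarrow> (\<exists>f. is_path T f \<and> computable_in (mart_oracle S) f)"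

end

theory Submission
  imports Defs "HOL-Library.Countable"
begin

text \<open>
  The martingale \<open>S\<close> is built by forcing. A condition consists of a dyadic-valued martingale that is
  frozen up to some level and of a bounded martingale \<open>U\<close>, strictly smaller at that level, which
  \<open>S\<close> has to dominate. Since \<open>Sbar n []\<close> tends to 0, infinitely many \<open>Sbar n\<close> can be absorbed
  into \<open>U\<close>.

  To defeat a program \<open>e\<close>, use that a bounded martingale converges in \<open>L\<^sup>2\<close>: above a high enough level
  \<open>m\<close> one has \<open>U \<sigma> \<le> U (take m \<sigma>) + D \<sigma>\<close> with a bounded martingale \<open>D\<close> of small mean, so that \<open>S\<close>
  can be kept above \<open>U + 4 D\<close>. Rounding \<open>D\<close> puts it into a compact class of integer-valued
  supermartingales \<open>v\<close>, none of which exceeds \<open>D\<close> at level \<open>m\<close> by more than rounding. Ask, for an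
  input \<open>n\<close> and a bit \<open>i\<close>, whether every \<open>v\<close> of the class lies below a finite extension of \<open>S\<close> on which
  \<open>e\<close> outputs \<open>i\<close> at \<open>n\<close>; by compactness this is a semidecidable question. If it is answered
  positively for a bit that the tree forbids at \<open>n\<close>, take the extension found for \<open>D\<close>. If every
  \<open>n\<close> gets a positive answer and no answer is forbidden, the answers form a computable path, because the
  tree is homogeneous. Otherwise some \<open>n\<close> has counterexamples \<open>v\<^sub>0\<close> and \<open>v\<^sub>1\<close> for both bits, and
  demanding that \<open>S\<close> also dominate these makes \<open>e\<close> fail at \<open>n\<close>.
\<close>

section \<open>Total computable functions\<close>

text \<open>
  Arguments are given by an environment \<open>nat \<Rightarrow> nat\<close>, of which only the first \<open>k\<close> entries count, so that
  adding a variable amounts to shifting indices and the closure rules apply by unification.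
\<close>

definition comp_fun :: "nat \<Rightarrow> ((nat \<Rightarrow> nat) \<Rightarrow> nat) \<Rightarrow> bool" where
  "comp_fun k F \<longleftrightarrow> (\<exists>e. \<forall>xs. length xs = k \<longrightarrow> eval (\<lambda>_. 0) e xs (F (nth xs)))"

definition decidable :: "nat \<Rightarrow> ((nat \<Rightarrow> nat) \<Rightarrow> bool) \<Rightarrow> bool" where
  "decidable k P \<longleftrightarrow> comp_fun k (\<lambda>v. if P v then 1 else 0)"

lemma comp_fun_var: "i < k \<Longrightarrow> comp_fun k (\<lambda>v. v i)"
  unfolding comp_fun_def by (metis eval_proj)

text \<open>\<open>comp_fun\<close> speaks only of environments of the form \<open>nth xs\<close>,
  with the out-of-range values of \<open>nth\<close>; hence the composite is stated with
  \<open>nth (map ...)\<close> literally.\<close>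

lemma comp_fun_compose:
  assumes "\<forall>G \<in> set Gs. comp_fun k G" and "comp_fun (length Gs) F"
  shows "comp_fun k (\<lambda>v. F (nth (map (\<lambda>G. G v) Gs)))"
proof -
  define P where "P G g \<longleftrightarrow> (\<forall>xs. length xs = k \<longrightarrow> eval (\<lambda>_. 0) g xs (G (nth xs)))" for G g
  have "\<exists>gs. list_all2 P Gs gs"
    using assms(1)
  proof (induction Gs)
    case (Cons G Gs)
    then show ?case by (auto simp: comp_fun_def P_def[symmetric] intro: list_all2_Cons[THEN iffD2])
  qed auto
  then obtain gs where gs: "list_all2 P Gs gs" by blast
  obtain f where f: "\<forall>xs. length xs = length Gs \<longrightarrow> eval (\<lambda>_. 0) f xs (F (nth xs))"
    using assms(2) by (auto simp: comp_fun_def)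
  have "eval (\<lambda>_. 0) (Comp f gs) xs (F (nth (map (\<lambda>G. G (nth xs)) Gs)))" if "length xs = k" for xs
  proof (rule eval_comp)
    show "list_all2 (\<lambda>g y. eval (\<lambda>_. 0) g xs y) gs (map (\<lambda>G. G (nth xs)) Gs)"
      using gs that by (auto simp: list_all2_conv_all_nth P_def)
    show "eval (\<lambda>_. 0) f (map (\<lambda>G. G (nth xs)) Gs) (F (nth (map (\<lambda>G. G (nth xs)) Gs)))"
      using f by simp
  qed
  then show ?thesis unfolding comp_fun_def by blast
qed

lemma comp_fun_comp1:
  assumes "comp_fun 1 (\<lambda>v. f (v 0))" "comp_fun k G"
  shows "comp_fun k (\<lambda>v. f (G v))"
  using comp_fun_compose[of "[G]" k "\<lambda>v. f (v 0)"] assms by simp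

lemma comp_fun_comp2:
  assumes "comp_fun 2 (\<lambda>v. f (v 0) (v 1))" "comp_fun k G" "comp_fun k H"
  shows "comp_fun k (\<lambda>v. f (G v) (H v))"
  using comp_fun_compose[of "[G, H]" k "\<lambda>v. f (v 0) (v 1)"] assms by (simp add: numeral_2_eq_2)

lemma comp_fun_Suc: "comp_fun k F \<Longrightarrow> comp_fun k (\<lambda>v. Suc (F v))"
proof (rule comp_fun_comp1[where f = Suc])
  have "eval (\<lambda>_. 0) Succ xs (Suc (xs ! 0))" if "length xs = 1" for xs
    using that by (cases xs) (auto intro: eval_succ)
  then show "comp_fun 1 (\<lambda>v. Suc (v 0))"
    unfolding comp_fun_def by blast
qed

lemma comp_fun_const: "comp_fun k (\<lambda>v. c)"
proof (induction c)
  case 0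
  then show ?case unfolding comp_fun_def by (auto intro: eval_zero)
qed (rule comp_fun_Suc)

text \<open>The shift is exact: \<open>(y # ys) ! Suc i\<close> is \<open>ys ! i\<close> for every
  i, also out of range.\<close>

lemma comp_fun_weaken:
  assumes "comp_fun k F"
  shows "comp_fun (Suc k) (\<lambda>v. F (\<lambda>i. v (Suc i)))"
proof -
  obtain e where e: "\<forall>xs. length xs = k \<longrightarrow> eval (\<lambda>_. 0) e xs (F (nth xs))"
    using assms by (auto simp: comp_fun_def)
  have "eval (\<lambda>_. 0) (Comp e (map (\<lambda>i. Proj (Suc i)) [0..<k])) xs (F (\<lambda>i. xs ! Suc i))"
    if len: "length xs = Suc k" for xs
  proof -
    obtain y ys where xs: "xs = y # ys" "length ys = k"
      using len by (cases xs) auto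
    show ?thesis
    proof (rule eval_comp)
      have "eval (\<lambda>_. 0) (Proj (Suc i)) (y # ys) (ys ! i)" if "i < k" for i
        using eval_proj[of "Suc i" "y # ys"] that xs by simp
      then show "list_all2 (\<lambda>g y. eval (\<lambda>_. 0) g xs y) (map (\<lambda>i. Proj (Suc i)) [0..<k]) ys"
        using xs by (auto simp: list_all2_conv_all_nth)
      show "eval (\<lambda>_. 0) e ys (F (\<lambda>i. xs ! Suc i))"
        using e xs by simp
    qed
  qed
  then show ?thesis unfolding comp_fun_def by blast
qed

text \<open>The step function sees the counter as variable 0, the previous value as variable 1 and
  the parameters shifted by two, in the order in which \<open>Prec\<close> passes them.\<close>

lemma comp_fun_rec:
  assumes "comp_fun k F" "comp_fun (Suc (Suc k)) (\<lambda>v. g (\<lambda>i. v (Suc (Suc i))) (v 0) (v 1))" "comp_fun k N"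
  shows "comp_fun k (\<lambda>v. rec_nat (F v) (g v) (N v))"
proof -
  obtain f where f: "\<forall>xs. length xs = k \<longrightarrow> eval (\<lambda>_. 0) f xs (F (nth xs))"
    using assms(1) by (auto simp: comp_fun_def)
  obtain h where h: "\<forall>xs. length xs = Suc (Suc k) \<longrightarrow>
      eval (\<lambda>_. 0) h xs (g (\<lambda>i. xs ! Suc (Suc i)) (xs ! 0) (xs ! 1))"
    using assms(2) by (auto simp: comp_fun_def)
  have *: "eval (\<lambda>_. 0) (Prec f h) (n # xs) (rec_nat (F (nth xs)) (g (nth xs)) n)"
    if "length xs = k" for n xs
  proof (induction n)
    case 0
    then show ?case using f that by (auto intro: eval_prec0)
  next
    case (Suc n)
    show ?case
      by (rule eval_precS[OF Suc]) (use h[rule_format, of "n # _ # xs"] that in simp)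
  qed
  \<comment> \<open>The recursion argument is first a fresh variable 0; composition then substitutes
    \<open>N\<close> for it.\<close>
  have "comp_fun (Suc k) (\<lambda>v. rec_nat (F (\<lambda>i. v (Suc i))) (g (\<lambda>i. v (Suc i))) (v 0))"
    unfolding comp_fun_def
  proof (intro exI allI impI)
    fix xs :: "nat list" assume "length xs = Suc k"
    then show "eval (\<lambda>_. 0) (Prec f h) xs (rec_nat (F (\<lambda>i. xs ! Suc i)) (g (\<lambda>i. xs ! Suc i)) (xs ! 0))"
      using * by (cases xs) auto
  qed
  then obtain r where r: "\<forall>xs. length xs = Suc k \<longrightarrow> eval (\<lambda>_. 0) r xs
      (rec_nat (F (\<lambda>i. xs ! Suc i)) (g (\<lambda>i. xs ! Suc i)) (xs ! 0))"
    by (auto simp: comp_fun_def)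
  obtain c where c: "\<forall>xs. length xs = k \<longrightarrow> eval (\<lambda>_. 0) c xs (N (nth xs))"
    using assms(3) by (auto simp: comp_fun_def)
  have "eval (\<lambda>_. 0) (Comp r (c # map Proj [0..<k])) xs (rec_nat (F (nth xs)) (g (nth xs)) (N (nth xs)))"
    if "length xs = k" for xs
  proof (rule eval_comp)
    show "list_all2 (\<lambda>g y. eval (\<lambda>_. 0) g xs y) (c # map Proj [0..<k]) (N (nth xs) # xs)"
      using c that by (auto simp: list_all2_conv_all_nth[of _ "map Proj _"] intro: eval_proj)
    show "eval (\<lambda>_. 0) r (N (nth xs) # xs) (rec_nat (F (nth xs)) (g (nth xs)) (N (nth xs)))"
      using r[rule_format, of "N (nth xs) # xs"] that by simp
  qed
  then show ?thesis unfolding comp_fun_def by blast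
qed

lemma comp_fun_pred: "comp_fun k F \<Longrightarrow> comp_fun k (\<lambda>v. F v - 1)"
proof (rule comp_fun_comp1[where f = "\<lambda>x. x - 1"])
  have "comp_fun 1 (\<lambda>v. rec_nat 0 (\<lambda>n r. n) (v 0))"
    by (intro comp_fun_rec comp_fun_const comp_fun_var) auto
  moreover have "rec_nat 0 (\<lambda>n r. n) x = x - 1" for x :: nat by (cases x) auto
  ultimately show "comp_fun 1 (\<lambda>v. v 0 - 1)" by simp
qed

lemma comp_fun_add: "comp_fun k F \<Longrightarrow> comp_fun k G \<Longrightarrow> comp_fun k (\<lambda>v. F v + G v)"
proof -
  assume "comp_fun k F" "comp_fun k G"
  then have "comp_fun k (\<lambda>v. rec_nat (F v) (\<lambda>n r. Suc r) (G v))"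
    by (intro comp_fun_rec comp_fun_Suc comp_fun_var) auto
  moreover have "rec_nat x (\<lambda>n r. Suc r) y = x + y" for x y :: nat by (induction y) auto
  ultimately show ?thesis by simp
qed

lemma comp_fun_diff: "comp_fun k F \<Longrightarrow> comp_fun k G \<Longrightarrow> comp_fun k (\<lambda>v. F v - G v)"
proof -
  assume "comp_fun k F" "comp_fun k G"
  then have "comp_fun k (\<lambda>v. rec_nat (F v) (\<lambda>n r. r - 1) (G v))"
    by (intro comp_fun_rec comp_fun_pred comp_fun_var) auto
  moreover have "rec_nat x (\<lambda>n r. r - 1) y = x - y" for x y :: nat by (induction y) auto
  ultimately show ?thesis by simp
qed

lemma comp_fun_mult: "comp_fun k F \<Longrightarrow> comp_fun k G \<Longrightarrow> comp_fun k (\<lambda>v. F v * G v)"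
proof (rule comp_fun_comp2[where f = "(*)"])
  have "comp_fun 2 (\<lambda>v. rec_nat 0 (\<lambda>n r. v 0 + r) (v 1))"
    by (intro comp_fun_rec comp_fun_add comp_fun_var comp_fun_const) auto
  moreover have "rec_nat 0 (\<lambda>n r. x + r) y = x * y" for x y :: nat by (induction y) auto
  ultimately show "comp_fun 2 (\<lambda>v. v 0 * v 1)" by simp
qed

lemma comp_fun_power: "comp_fun k F \<Longrightarrow> comp_fun k G \<Longrightarrow> comp_fun k (\<lambda>v. F v ^ G v)"
proof (rule comp_fun_comp2[where f = "(^)"])
  have "comp_fun 2 (\<lambda>v. rec_nat 1 (\<lambda>n r. v 0 * r) (v 1))"
    by (intro comp_fun_rec comp_fun_mult comp_fun_var comp_fun_const) auto
  moreover have "rec_nat 1 (\<lambda>n r. x * r) y = x ^ y" for x y :: nat by (induction y) auto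
  ultimately show "comp_fun 2 (\<lambda>v. v 0 ^ v 1)" by simp
qed

lemma comp_fun_if:
  assumes "decidable k P" "comp_fun k F" "comp_fun k G"
  shows "comp_fun k (\<lambda>v. if P v then F v else G v)"
proof -
  have "comp_fun k (\<lambda>v. (if P v then 1 else 0) * F v + (1 - (if P v then 1 else 0)) * G v)"
    using assms unfolding decidable_def by (intro comp_fun_add comp_fun_mult comp_fun_diff comp_fun_const)
  moreover have "(\<lambda>v. (if P v then 1 else 0) * F v + (1 - (if P v then 1 else 0)) * G v)
      = (\<lambda>v. if P v then F v else G v)" by auto
  ultimately show ?thesis by simp
qed

lemma decidable_cong: "(\<And>v. P v \<longleftrightarrow> Q v) \<Longrightarrow> decidable k P \<Longrightarrow> decidable k Q"
  by (simp add: decidable_def)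

lemma decidable_const: "decidable k (\<lambda>v. b)"
  unfolding decidable_def by (rule comp_fun_const)

lemma decidable_zero: "comp_fun k F \<Longrightarrow> decidable k (\<lambda>v. F v = 0)"
proof -
  assume "comp_fun k F"
  then have "comp_fun k (\<lambda>v. 1 - F v)" by (intro comp_fun_diff comp_fun_const)
  moreover have "(\<lambda>v. 1 - F v) = (\<lambda>v. if F v = 0 then 1 else 0)" by auto
  ultimately show ?thesis by (simp add: decidable_def)
qed

lemma decidable_not: "decidable k P \<Longrightarrow> decidable k (\<lambda>v. \<not> P v)"
  unfolding decidable_def[of k P] by (drule decidable_zero, erule decidable_cong[rotated]) auto

lemma decidable_conj:
  assumes "decidable k P" "decidable k Q"
  shows "decidable k (\<lambda>v. P v \<and> Q v)"
proof -
  have "comp_fun k (\<lambda>v. if P v then (if Q v then 1 else 0) else 0)"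
    using assms by (intro comp_fun_if comp_fun_const)
  moreover have "(\<lambda>v. if P v then (if Q v then 1 else 0) else 0) = (\<lambda>v. if P v \<and> Q v then 1 else (0::nat))"
    by auto
  ultimately show ?thesis by (simp add: decidable_def)
qed

lemma decidable_disj: "decidable k P \<Longrightarrow> decidable k Q \<Longrightarrow> decidable k (\<lambda>v. P v \<or> Q v)"
  using decidable_not[OF decidable_conj[OF decidable_not decidable_not], of k P Q] by simp

lemma decidable_imp: "decidable k P \<Longrightarrow> decidable k Q \<Longrightarrow> decidable k (\<lambda>v. P v \<longrightarrow> Q v)"
  using decidable_disj[OF decidable_not, of k P Q] by simp

lemma decidable_le: "comp_fun k F \<Longrightarrow> comp_fun k G \<Longrightarrow> decidable k (\<lambda>v. F v \<le> G v)"
  using decidable_zero[OF comp_fun_diff, of k F G] by simp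

lemma decidable_less: "comp_fun k F \<Longrightarrow> comp_fun k G \<Longrightarrow> decidable k (\<lambda>v. F v < G v)"
  using decidable_le[OF comp_fun_Suc, of k F G] by (simp add: Suc_le_eq)

lemma decidable_eq: "comp_fun k F \<Longrightarrow> comp_fun k G \<Longrightarrow> decidable k (\<lambda>v. F v = G v)"
  using decidable_conj[OF decidable_le decidable_le, of k F G G F] by (simp add: eq_iff)

lemma decidable_all_less:
  assumes "comp_fun k N" "decidable (Suc k) (\<lambda>v. P (\<lambda>i. v (Suc i)) (v 0))"
  shows "decidable k (\<lambda>v. \<forall>i < N v. P v i)"
proof -
  \<comment> \<open>The accumulator of the recursion sits at index 1, whereas
    \<open>comp_fun_weaken\<close> inserts a variable at index 0. Composition with projections skips
    index 1.\<close>
  have *: "decidable (Suc (Suc k)) (\<lambda>v. P (\<lambda>i. v (Suc (Suc i))) (v 0))"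
  proof -
    have "comp_fun (Suc (Suc k)) (\<lambda>v. (\<lambda>w. if P (\<lambda>i. w (Suc i)) (w 0) then 1 else 0)
      (\<lambda>j. (map (\<lambda>G. G v) ((\<lambda>v. v 0) # map (\<lambda>i v. v (Suc (Suc i))) [0..<k])) ! j))"
      by (rule comp_fun_compose) (use assms(2) in \<open>auto simp: decidable_def intro: comp_fun_var\<close>)
    then obtain e where e: "\<forall>xs. length xs = Suc (Suc k) \<longrightarrow> eval (\<lambda>_. 0) e xs
      ((\<lambda>w. if P (\<lambda>i. w (Suc i)) (w 0) then 1 else 0)
      (\<lambda>j. (map (\<lambda>G. G (nth xs)) ((\<lambda>v. v 0) # map (\<lambda>i v. v (Suc (Suc i))) [0..<k])) ! j))"
      unfolding comp_fun_def by blast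
    have "map (\<lambda>G. G (nth (x # y # zs))) ((\<lambda>v. v 0) # map (\<lambda>i v. v (Suc (Suc i))) [0..<k]) = x # zs"
      if "length zs = k" for x y :: nat and zs
      using that by (intro nth_equalityI) (auto simp: nth_Cons split: nat.splits)
    then have "eval (\<lambda>_. 0) e (x # y # zs) (if P (nth zs) x then 1 else 0)"
      if "length zs = k" for x y zs
      using e[rule_format, of "x # y # zs"] that by (simp del: list.map)
    then have "eval (\<lambda>_. 0) e xs (if P (\<lambda>i. xs ! Suc (Suc i)) (xs ! 0) then 1 else 0)"
      if "length xs = Suc (Suc k)" for xs
      using that by (cases xs; cases "tl xs") auto
    then show ?thesis unfolding decidable_def comp_fun_def by blast
  qed
  have "comp_fun k (\<lambda>v. rec_nat 1 (\<lambda>i r. if P v i then r else 0) (N v))"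
    using assms(1) * by (intro comp_fun_rec comp_fun_const comp_fun_if comp_fun_var) auto
  moreover have "rec_nat 1 (\<lambda>i r. if P v i then r else 0) n = (if \<forall>i < n. P v i then 1 else (0::nat))" for v n
    by (induction n) (auto simp: less_Suc_eq)
  ultimately show ?thesis by (simp add: decidable_def)
qed

lemma decidable_ex_less:
  assumes "comp_fun k N" "decidable (Suc k) (\<lambda>v. P (\<lambda>i. v (Suc i)) (v 0))"
  shows "decidable k (\<lambda>v. \<exists>i < N v. P v i)"
  using decidable_not[OF decidable_all_less[OF assms(1) decidable_not[OF assms(2)]]] by simp

text \<open>\<open>Minim\<close> looks for a zero, so it is applied to the negated test.\<close>

lemma comp_fun_Least:
  assumes "decidable (Suc k) (\<lambda>v. P (\<lambda>i. v (Suc i)) (v 0))" and "\<And>v. \<exists>y. P v y"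
  shows "comp_fun k (\<lambda>v. LEAST y. P v y)"
proof -
  have "decidable (Suc k) (\<lambda>v. \<not> P (\<lambda>i. v (Suc i)) (v 0))" by (intro decidable_not assms)
  then obtain e where e: "\<forall>xs. length xs = Suc k \<longrightarrow>
      eval (\<lambda>_. 0) e xs (if \<not> P (\<lambda>i. xs ! Suc i) (xs ! 0) then 1 else 0)"
    unfolding decidable_def comp_fun_def by auto
  have e': "eval (\<lambda>_. 0) e (y # xs) (if \<not> P (nth xs) y then 1 else 0)" if "length xs = k" for y xs
    using e[rule_format, of "y # xs"] that by simp
  have "eval (\<lambda>_. 0) (Minim e) xs (LEAST y. P (nth xs) y)" if "length xs = k" for xs
  proof (rule eval_minim)
    have "P (nth xs) (LEAST y. P (nth xs) y)" using assms(2) by (metis LeastI_ex)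
    then show "eval (\<lambda>_. 0) e ((LEAST y. P (nth xs) y) # xs) 0"
      using e'[OF that, of "LEAST y. P (nth xs) y"] by simp
    show "\<forall>z < (LEAST y. P (nth xs) y). \<exists>v > 0. eval (\<lambda>_. 0) e (z # xs) v"
    proof (intro allI impI)
      fix z assume "z < (LEAST y. P (nth xs) y)"
      then have "\<not> P (nth xs) z" by (rule not_less_Least)
      then show "\<exists>v > 0. eval (\<lambda>_. 0) e (z # xs) v" using e'[OF that, of z] by (intro exI[of _ 1]) simp
    qed
  qed
  then show ?thesis unfolding comp_fun_def by blast
qed

text \<open>The value is found by unbounded search, which ends because \<open>F\<close> is
  total.\<close>

lemma comp_fun_graph:
  assumes "decidable (Suc k) (\<lambda>v. v 0 = F (\<lambda>i. v (Suc i)))"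
  shows "comp_fun k F"
proof -
  have "comp_fun k (\<lambda>v. LEAST y. y = F v)" using assms by (rule comp_fun_Least) auto
  moreover have "(\<lambda>v. LEAST y. y = F v) = F" by (auto intro: Least_equality)
  ultimately show ?thesis by simp
qed

lemmas comp_fun_arith = comp_fun_add comp_fun_diff comp_fun_mult comp_fun_power comp_fun_Suc comp_fun_if
lemmas decidable_basic = decidable_le decidable_less decidable_eq decidable_conj decidable_disj
  decidable_imp decidable_not decidable_all_less decidable_ex_less

lemma comp_fun_div: "comp_fun k F \<Longrightarrow> comp_fun k G \<Longrightarrow> comp_fun k (\<lambda>v. F v div G v)"
proof (rule comp_fun_comp2[where f = "(div)"])
  \<comment> \<open>The first disjunct is the convention that division by 0 gives 0.\<close>
  have "decidable 3 (\<lambda>v. (v 2 = 0 \<and> v 0 = 0) \<or> (0 < v 2 \<and> v 0 * v 2 \<le> v 1 \<and> v 1 < (v 0 + 1) * v 2))"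
    by (intro decidable_basic comp_fun_arith comp_fun_var comp_fun_const) auto
  moreover have "(b = 0 \<and> c = 0) \<or> (0 < b \<and> c * b \<le> a \<and> a < (c + 1) * b) \<longleftrightarrow> c = a div b" for a b c :: nat
    by (cases "b = 0") (auto simp: algebra_simps dividend_less_times_div intro: div_nat_eqI[symmetric])
  ultimately have "decidable 3 (\<lambda>v. v 0 = v 1 div v 2)" by simp
  then show "comp_fun 2 (\<lambda>v. v 0 div v 1)"
    by (intro comp_fun_graph) (simp add: numeral_3_eq_3 numeral_2_eq_2)
qed

lemma comp_fun_mod: "comp_fun k F \<Longrightarrow> comp_fun k G \<Longrightarrow> comp_fun k (\<lambda>v. F v mod G v)"
proof -
  assume "comp_fun k F" "comp_fun k G"
  then have "comp_fun k (\<lambda>v. F v - F v div G v * G v)" by (intro comp_fun_arith comp_fun_div)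
  then show ?thesis by (simp add: minus_div_mult_eq_mod)
qed

text \<open>Makes the pairing an arithmetic term. Decoding one component is then a matter of
  searching for the other, which is bounded by the code.\<close>

lemma prod_encode_div: "prod_encode (a, b) = (a + b) * Suc (a + b) div 2 + a"
  unfolding prod_encode_def triangle_def case_prod_conv ..

lemma comp_fun_fst_prod_decode: "comp_fun k F \<Longrightarrow> comp_fun k (\<lambda>v. fst (prod_decode (F v)))"
proof (rule comp_fun_comp1[where f = "\<lambda>z. fst (prod_decode z)"], rule comp_fun_graph)
  have "decidable 2 (\<lambda>v. \<exists>b < Suc (v 1). (v 0 + b) * Suc (v 0 + b) div 2 + v 0 = v 1)"
    by (intro decidable_basic comp_fun_arith comp_fun_div comp_fun_var comp_fun_const) auto
  moreover have "(\<exists>b < Suc z. (a + b) * Suc (a + b) div 2 + a = z) \<longleftrightarrow> a = fst (prod_decode z)" for a z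
  proof
    assume "a = fst (prod_decode z)"
    then have *: "prod_encode (a, snd (prod_decode z)) = z" by simp
    then have "snd (prod_decode z) < Suc z"
      using le_prod_encode_2[of "snd (prod_decode z)" a] by simp
    then show "\<exists>b < Suc z. (a + b) * Suc (a + b) div 2 + a = z"
      using * unfolding prod_encode_div by blast
  next
    assume "\<exists>b < Suc z. (a + b) * Suc (a + b) div 2 + a = z"
    then show "a = fst (prod_decode z)" unfolding prod_encode_div[symmetric] by auto
  qed
  ultimately have "decidable 2 (\<lambda>v. v 0 = fst (prod_decode (v 1)))" by (simp only:)
  then show "decidable (Suc 1) (\<lambda>v. v 0 = fst (prod_decode (v (Suc 0))))" by (simp add: numeral_2_eq_2)
qed

lemma comp_fun_snd_prod_decode: "comp_fun k F \<Longrightarrow> comp_fun k (\<lambda>v. snd (prod_decode (F v)))"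
proof (rule comp_fun_comp1[where f = "\<lambda>z. snd (prod_decode z)"], rule comp_fun_graph)
  have "decidable 2 (\<lambda>v. \<exists>a < Suc (v 1). (a + v 0) * Suc (a + v 0) div 2 + a = v 1)"
    by (intro decidable_basic comp_fun_arith comp_fun_div comp_fun_var comp_fun_const) auto
  moreover have "(\<exists>a < Suc z. (a + b) * Suc (a + b) div 2 + a = z) \<longleftrightarrow> b = snd (prod_decode z)" for b z
  proof
    assume "b = snd (prod_decode z)"
    then have *: "prod_encode (fst (prod_decode z), b) = z" by simp
    then have "fst (prod_decode z) < Suc z"
      using le_prod_encode_1[of "fst (prod_decode z)" b] by simp
    then show "\<exists>a < Suc z. (a + b) * Suc (a + b) div 2 + a = z"
      using * unfolding prod_encode_div by blast
  next
    assume "\<exists>a < Suc z. (a + b) * Suc (a + b) div 2 + a = z"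
    then show "b = snd (prod_decode z)" unfolding prod_encode_div[symmetric] by auto
  qed
  ultimately have "decidable 2 (\<lambda>v. v 0 = snd (prod_decode (v 1)))" by (simp only:)
  then show "decidable (Suc 1) (\<lambda>v. v 0 = snd (prod_decode (v (Suc 0))))" by (simp add: numeral_2_eq_2)
qed

text \<open>Finitely many values of an arbitrary \<open>f\<close> can be wired into a program.
  Tables read off noncomputable martingales thus become available to the decision procedure.\<close>

lemma comp_fun_finite_support: "comp_fun k F \<Longrightarrow> comp_fun k (\<lambda>v. if F v < N then f (F v) else 0)"
proof (induction N)
  case 0
  show ?case by (simp only: less_zeroE if_False comp_fun_const not_less_zero)
next
  case (Suc N)
  have eq: "(if x < Suc N then f x else 0) = (if x = N then f N else if x < N then f x else 0)" for x
    by auto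
  show ?case
    unfolding eq by (rule comp_fun_if[OF decidable_eq[OF Suc.prems comp_fun_const] comp_fun_const Suc.IH[OF Suc.prems]])
qed

section \<open>Bounded simulation of oracle programs\<close>

text \<open>
  The value 0 means undefined and \<open>Suc y\<close> means \<open>y\<close>, both for the result and for the answers of the
  partial oracle \<open>L\<close>; unbounded searches stop at \<open>s\<close>. The recursion over the program replaces a
  universal machine.
\<close>

fun sim :: "recf \<Rightarrow> (nat \<Rightarrow> nat) \<Rightarrow> nat \<Rightarrow> nat list \<Rightarrow> nat" where
  "sim Zero L s xs = 1"
| "sim Succ L s xs = (case xs of [] \<Rightarrow> 0 | x # _ \<Rightarrow> Suc (Suc x))"
| "sim (Proj i) L s xs = (if i < length xs then Suc (xs ! i) else 0)"
| "sim (Comp f gs) L s xs =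
    (if \<exists>g \<in> set gs. sim g L s xs = 0 then 0
     else sim f L s (map (\<lambda>g. sim g L s xs - 1) gs))"
| "sim (Prec f g) L s xs = (case xs of [] \<Rightarrow> 0 | x # ys \<Rightarrow>
    rec_nat (sim f L s ys) (\<lambda>n r. if r = 0 then 0 else sim g L s (n # (r - 1) # ys)) x)"
| "sim (Minim f) L s xs =
    rec_nat 0 (\<lambda>y r. if r \<noteq> 0 then r
      else if sim f L s (y # xs) = 1 \<and> (\<forall>z < y. 2 \<le> sim f L s (z # xs)) then Suc y else 0) s"
| "sim Orc L s xs = (case xs of [] \<Rightarrow> 0 | x # _ \<Rightarrow> L x)"

text \<open>A simulation relies only on answers that \<open>L\<close> actually gives, so a finite
  part of the oracle can certify a computation.\<close>

lemma sim_sound: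
  assumes "\<And>x a. L x = Suc a \<Longrightarrow> A x = a"
  shows "sim e L s xs = Suc y \<Longrightarrow> eval A e xs y"
proof (induction e arbitrary: xs y)
  case Zero
  then show ?case by (auto intro: eval_zero)
next
  case Succ
  then show ?case by (auto intro: eval_succ split: list.splits)
next
  case (Proj i)
  then show ?case by (auto intro: eval_proj split: if_splits)
next
  case (Comp f gs)
  have nz: "\<forall>g \<in> set gs. sim g L s xs \<noteq> 0"
    using Comp.prems by (auto split: if_splits)
  show ?case
  proof (rule eval_comp)
    show "eval A f (map (\<lambda>g. sim g L s xs - 1) gs) y"
      using Comp nz by (auto split: if_splits)
    show "list_all2 (\<lambda>g y. eval A g xs y) gs (map (\<lambda>g. sim g L s xs - 1) gs)"
      using Comp nz by (auto simp: list_all2_conv_all_nth)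
  qed
next
  case (Prec f g)
  then obtain x ys where xs: "xs = x # ys" by (auto split: list.splits)
  define R where "R = rec_nat (sim f L s ys) (\<lambda>n r. if r = 0 then 0 else sim g L s (n # (r - 1) # ys))"
  have "R n = Suc y \<Longrightarrow> eval A (Prec f g) (n # ys) y" for n y
  proof (induction n arbitrary: y)
    case 0
    then show ?case using Prec.IH(1) by (auto simp: R_def intro: eval_prec0)
  next
    case (Suc n)
    then obtain r where r: "R n = Suc r" "sim g L s (n # r # ys) = Suc y"
      by (cases "R n") (auto simp: R_def split: if_splits)
    show ?case
      using eval_precS[OF Suc.IH[OF r(1)]] Prec.IH(2)[of "n # r # ys" y] r by auto
  qed
  then show ?case using Prec.prems by (simp add: xs R_def)
next
  case (Minim f)
  \<comment> \<open>Once the search holds a value it keeps it, so the value was recorded when its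
    test succeeded.\<close>
  have "rec_nat 0 (\<lambda>y r. if r \<noteq> 0 then r
      else if sim f L s (y # xs) = 1 \<and> (\<forall>z < y. 2 \<le> sim f L s (z # xs)) then Suc y else 0) t = Suc y
      \<Longrightarrow> sim f L s (y # xs) = 1 \<and> (\<forall>z < y. 2 \<le> sim f L s (z # xs))" for t
    by (induction t) (auto split: if_splits)
  with Minim.prems have *: "sim f L s (y # xs) = 1" "\<forall>z < y. 2 \<le> sim f L s (z # xs)" by auto
  show ?case
  proof (rule eval_minim)
    show "eval A f (y # xs) 0" using Minim * by simp
    show "\<forall>z < y. \<exists>v > 0. eval A f (z # xs) v"
    proof (intro allI impI)
      fix z assume "z < y"
      then have "2 \<le> sim f L s (z # xs)" using *(2) by blast
      then obtain v where "sim f L s (z # xs) = Suc (Suc v)"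
        by (metis Suc_le_D Suc_le_mono numeral_2_eq_2)
      then show "\<exists>v > 0. eval A f (z # xs) v" using Minim by blast
    qed
  qed
next
  case Orc
  then show ?case using assms by (auto intro: eval_orc split: list.splits)
qed

text \<open>A halting computation asks finitely many questions and makes finitely many searches, so
  only finitely many eventual conditions on \<open>t\<close> have to be intersected.\<close>

lemma sim_complete:
  assumes "\<And>x. eventually (\<lambda>t. L t x = Suc (A x)) sequentially"
  shows "eval A e xs y \<Longrightarrow> eventually (\<lambda>t. sim e (L t) t xs = Suc y) sequentially"
proof (induction rule: eval.induct)
  case (eval_comp xs gs ys f y)
  have "list_all2 (\<lambda>g y. eventually (\<lambda>t. sim g (L t) t xs = Suc y) sequentially) gs ys"
    using eval_comp.hyps(1) eval_comp.IH(1) by (auto elim!: list_all2_mono)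
  then have "eventually (\<lambda>t. list_all2 (\<lambda>g y. sim g (L t) t xs = Suc y) gs ys) sequentially"
    by induction (auto elim: eventually_elim2)
  with eval_comp.IH(2) show ?case
  proof eventually_elim
    case (elim t)
    then have "\<forall>g \<in> set gs. sim g (L t) t xs \<noteq> 0" "map (\<lambda>g. sim g (L t) t xs - 1) gs = ys"
      by (auto simp: list_all2_conv_all_nth in_set_conv_nth intro: nth_equalityI)
    then show ?case using elim by auto
  qed
next
  case (eval_precS f g n xs r y)
  from eval_precS.IH(1) eval_precS.IH(2) show ?case
    by eventually_elim auto
next
  case (eval_minim f y xs)
  have "eventually (\<lambda>t. \<forall>z \<in> {..<y}. 2 \<le> sim f (L t) t (z # xs)) sequentially"
  proof (rule eventually_ball_finite)
    show "\<forall>z \<in> {..<y}. eventually (\<lambda>t. 2 \<le> sim f (L t) t (z # xs)) sequentially"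
    proof
      fix z assume "z \<in> {..<y}"
      then obtain v where v: "v > 0" "eventually (\<lambda>t. sim f (L t) t (z # xs) = Suc v) sequentially"
        using eval_minim by blast
      from v(2) show "eventually (\<lambda>t. 2 \<le> sim f (L t) t (z # xs)) sequentially"
        by eventually_elim (use v(1) in auto)
    qed
  qed auto
  with eval_minim.IH(1) eventually_gt_at_top[of y] show ?case
  proof eventually_elim
    case (elim t)
    define R where "R = rec_nat 0 (\<lambda>y r. if r \<noteq> 0 then r
      else if sim f (L t) t (y # xs) = 1 \<and> (\<forall>z < y. 2 \<le> sim f (L t) t (z # xs)) then Suc y else 0)"
    \<comment> \<open>The search holds nothing before it has tested \<open>y\<close>, then records
      \<open>Suc y\<close> and keeps it; \<open>y < t\<close> lets it get that far.\<close>
    have "R z = 0" if "z \<le> y" for z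
      using that
    proof (induction z)
      case (Suc z)
      then have "2 \<le> sim f (L t) t (z # xs)" "R z = 0" using elim(3) by auto
      then show ?case by (auto simp: R_def)
    qed (simp add: R_def)
    then have "R (Suc y) = Suc y" using elim by (auto simp: R_def)
    moreover have "R (Suc y + d) = R (Suc y)" for d
      using \<open>R (Suc y) = Suc y\<close> by (induction d) (auto simp: R_def)
    ultimately have "R t = Suc y" using elim(2) by (metis Suc_leI le_add_diff_inverse)
    then show ?case by (simp add: R_def)
  qed
next
  case (eval_orc x xs)
  then show ?case using assms by simp
qed auto

text \<open>Both outputs are the eventual value of the same simulation with the full oracle, and
  \<open>sim\<close> is a function.\<close>

lemma eval_deterministic:
  assumes "eval A e xs y" "eval A e xs z"
  shows "y = z"
proof -
  have *: "eventually (\<lambda>t::nat. Suc (A x) = Suc (A x)) sequentially" for x by simp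
  have "eventually (\<lambda>t. y = z) sequentially"
    using sim_complete[of "\<lambda>_ x. Suc (A x)", OF * assms(1)] sim_complete[of "\<lambda>_ x. Suc (A x)", OF * assms(2)]
    by eventually_elim simp
  then show ?thesis by simp
qed

text \<open>Induction on the program, general in the arity and all arguments because recursion and
  search introduce variables. The list \<pi> holds the parameters that determine the partial
  oracle.\<close>

lemma comp_fun_sim:
  assumes L: "\<And>k \<pi> x. \<forall>p \<in> set \<pi>. comp_fun k p \<Longrightarrow> length \<pi> = N \<Longrightarrow> comp_fun k x \<Longrightarrow>
      comp_fun k (\<lambda>v. L (map (\<lambda>p. p v) \<pi>) (x v))"
  shows "\<forall>p \<in> set \<pi>. comp_fun k p \<Longrightarrow> length \<pi> = N \<Longrightarrow> comp_fun k s \<Longrightarrow> \<forall>G \<in> set Gs. comp_fun k G \<Longrightarrow>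
    comp_fun k (\<lambda>v. sim e (L (map (\<lambda>p. p v) \<pi>)) (s v) (map (\<lambda>G. G v) Gs))"
proof (induction e arbitrary: k \<pi> s Gs)
  case Zero
  then show ?case by (simp add: comp_fun_const)
next
  case Succ
  then show ?case by (cases Gs) (auto intro!: comp_fun_Suc comp_fun_const)
next
  case (Proj i)
  then show ?case by (cases "i < length Gs") (auto intro!: comp_fun_Suc comp_fun_const)
next
  case (Comp f gs)
  have g: "comp_fun k (\<lambda>v. sim g (L (map (\<lambda>p. p v) \<pi>)) (s v) (map (\<lambda>G. G v) Gs))" if "g \<in> set gs" for g
    using Comp that by blast
  have "decidable k (\<lambda>v. \<exists>g \<in> set hs. sim g (L (map (\<lambda>p. p v) \<pi>)) (s v) (map (\<lambda>G. G v) Gs) = 0)"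
    if "set hs \<subseteq> set gs" for hs
    using that
  proof (induction hs)
    case (Cons h hs)
    then show ?case using g by (auto intro!: decidable_disj decidable_zero)
  qed (simp add: decidable_const)
  moreover have "comp_fun k (\<lambda>v. sim f (L (map (\<lambda>p. p v) \<pi>)) (s v) (map (\<lambda>G. G v)
      (map (\<lambda>g v. sim g (L (map (\<lambda>p. p v) \<pi>)) (s v) (map (\<lambda>G. G v) Gs) - 1) gs)))"
    using Comp.prems g by (intro Comp.IH(1)) (auto intro!: comp_fun_pred[simplified])
  ultimately show ?case
    by (auto intro!: comp_fun_if comp_fun_const simp: comp_def)
next
  case (Prec f g)
  show ?case
  proof (cases Gs)
    case Nil
    then show ?thesis by (simp add: comp_fun_const)
  next
    case (Cons G Hs)
    \<comment> \<open>Recursion adds two variables, the counter and the coded previous value;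
      \<open>v 1 - 1\<close> undoes the code.\<close>
    define up :: "((nat \<Rightarrow> nat) \<Rightarrow> nat) \<Rightarrow> (nat \<Rightarrow> nat) \<Rightarrow> nat" where "up F = (\<lambda>v. F (\<lambda>i. v (Suc (Suc i))))" for F
    have up: "comp_fun (Suc (Suc k)) (up F)" if "comp_fun k F" for F
      using comp_fun_weaken[OF comp_fun_weaken[OF that]] by (simp add: up_def)
    have "comp_fun (Suc (Suc k)) (\<lambda>v. sim g (L (map (\<lambda>p. p v) (map up \<pi>))) (up s v)
       (map (\<lambda>G. G v) ((\<lambda>v. v 0) # (\<lambda>v. v 1 - 1) # map up Hs)))"
      using Prec.prems Cons by (intro Prec.IH(2)) (auto intro!: comp_fun_var up comp_fun_pred[simplified])
    then have "comp_fun (Suc (Suc k)) (\<lambda>v. if v 1 = 0 then 0 else sim g (L (map (\<lambda>p. p (\<lambda>i. v (Suc (Suc i)))) \<pi>))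
         (s (\<lambda>i. v (Suc (Suc i)))) (v 0 # (v 1 - 1) # map (\<lambda>G. G (\<lambda>i. v (Suc (Suc i)))) Hs))"
      by (intro comp_fun_if decidable_zero comp_fun_var comp_fun_const) (auto simp: comp_def up_def)
    moreover have "comp_fun k (\<lambda>v. sim f (L (map (\<lambda>p. p v) \<pi>)) (s v) (map (\<lambda>G. G v) Hs))"
      using Prec.prems Cons by (intro Prec.IH(1)) auto
    ultimately show ?thesis
      using Prec.prems Cons by (auto intro!: comp_fun_rec)
  qed
next
  case (Minim f)
  define up :: "((nat \<Rightarrow> nat) \<Rightarrow> nat) \<Rightarrow> (nat \<Rightarrow> nat) \<Rightarrow> nat" where "up F = (\<lambda>v. F (\<lambda>i. v (Suc i)))" for F
  have up: "comp_fun (Suc k) (up F)" if "comp_fun k F" for F k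
    using comp_fun_weaken[OF that] by (simp add: up_def)
  \<comment> \<open>This is the test at \<open>y\<close>, two variables deep inside the recursion;
    the next fact is the test at \<open>z\<close>, one bounded quantifier deeper.\<close>
  have 1: "comp_fun (Suc (Suc k)) (\<lambda>v. sim f (L (map (\<lambda>p. p v) (map (up \<circ> up) \<pi>))) ((up \<circ> up) s v)
       (map (\<lambda>G. G v) ((\<lambda>v. v 0) # map (up \<circ> up) Gs)))"
    using Minim.prems by (intro Minim.IH) (auto intro!: comp_fun_var up)
  have 2: "comp_fun (Suc (Suc (Suc k))) (\<lambda>v. sim f (L (map (\<lambda>p. p v) (map (up \<circ> up \<circ> up) \<pi>))) ((up \<circ> up \<circ> up) s v)
       (map (\<lambda>G. G v) ((\<lambda>v. v 0) # map (up \<circ> up \<circ> up) Gs)))"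
    using Minim.prems by (intro Minim.IH) (auto intro!: comp_fun_var up)
  show ?case
    unfolding sim.simps
    using 1 2 Minim.prems
    by (intro comp_fun_rec comp_fun_if comp_fun_const comp_fun_var decidable_conj decidable_not
        decidable_all_less decidable_le decidable_eq comp_fun_Suc)
      (auto simp: comp_def up_def)
next
  case Orc
  then show ?case by (cases Gs) (auto intro!: comp_fun_const L)
qed

section \<open>Finite tables and the oracles they determine\<close>

text \<open>A numeral in base \<open>b\<close> serves as a finite table, so that quantifiers over
  tables become quantifiers over numbers.\<close>

definition digit :: "nat \<Rightarrow> nat \<Rightarrow> nat \<Rightarrow> nat" where
  "digit b t j = t div b ^ j mod b"

lemma digit_table:
  assumes "\<And>j. j < N \<Longrightarrow> f j < b"
  shows "\<exists>t < b ^ N. \<forall>j < N. digit b t j = f j"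
  using assms
proof (induction N)
  case (Suc N)
  then obtain t where t: "t < b ^ N" "\<forall>j < N. digit b t j = f j" by auto
  have "f N < b" using Suc by auto
  then have b: "b > 0" by auto
  have "digit b (t + f N * b ^ N) j = f j" if "j < Suc N" for j
  proof (cases "j = N")
    case True
    then show ?thesis using t(1) b \<open>f N < b\<close> by (simp add: digit_def)
  next
    case False
    then have "j < N" using that by simp
    \<comment> \<open>The new leading digit contributes a multiple of \<open>b ^ Suc j\<close> and
      so leaves digit \<open>j\<close> alone.\<close>
    then have "b ^ N = b ^ j * b * b ^ (N - Suc j)"
      by (metis Suc_leI le_add_diff_inverse power_Suc2 power_add)
    then have *: "t + f N * b ^ N = t + b ^ j * (b * (f N * b ^ (N - Suc j)))" by simp
    have "digit b (t + f N * b ^ N) j = digit b t j"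
      unfolding digit_def * using b by (simp del: mult.assoc)
    then show ?thesis using t(2) \<open>j < N\<close> by simp
  qed
  moreover have "t + f N * b ^ N < b ^ Suc N"
  proof -
    have "t + f N * b ^ N < Suc (f N) * b ^ N" using t(1) by simp
    also have "\<dots> \<le> b * b ^ N" using \<open>f N < b\<close> by (intro mult_right_mono) auto
    finally show ?thesis by simp
  qed
  ultimately show ?case by blast
qed simp

lemma comp_fun_digit: "comp_fun k b \<Longrightarrow> comp_fun k t \<Longrightarrow> comp_fun k j \<Longrightarrow> comp_fun k (\<lambda>v. digit (b v) (t v) (j v))"
  unfolding digit_def by (intro comp_fun_mod comp_fun_div comp_fun_power)

text \<open>Heap numbering of binary strings: the children of node \<open>j\<close> are \<open>2 * j\<close> and \<open>2 * j + 1\<close>.\<close>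

definition idx :: "bool list \<Rightarrow> nat" where
  "idx \<sigma> = foldl (\<lambda>j b. 2 * j + (if b then 1 else 0)) 1 \<sigma>"

lemma idx_Nil [simp]: "idx [] = 1"
  by (simp add: idx_def)

lemma idx_snoc [simp]: "idx (\<sigma> @ [b]) = 2 * idx \<sigma> + (if b then 1 else 0)"
  by (simp add: idx_def)

lemma idx_ge: "2 ^ length \<sigma> \<le> idx \<sigma>"
  by (induction \<sigma> rule: rev_induct) auto

lemma idx_less: "idx \<sigma> < 2 * 2 ^ length \<sigma>"
  by (induction \<sigma> rule: rev_induct) auto

lemma idx_surj: "0 < j \<Longrightarrow> \<exists>\<sigma>. idx \<sigma> = j"
proof (induction j rule: less_induct)
  case (less j)
  show ?case
  proof (cases "j = 1")
    case True
    then show ?thesis by (intro exI[of _ "[]"]) simp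
  next
    case False
    then have "0 < j div 2" "j div 2 < j" using less.prems by auto
    then obtain \<sigma> where "idx \<sigma> = j div 2" using less.IH by blast
    then have "idx (\<sigma> @ [odd j]) = j" by simp
    then show ?thesis by blast
  qed
qed

lemma idx_inj: "idx \<sigma> = idx \<tau> \<Longrightarrow> \<sigma> = \<tau>"
proof (induction \<sigma> arbitrary: \<tau> rule: rev_induct)
  case Nil
  show ?case
  proof (cases \<tau> rule: rev_cases)
    case (snoc ys y)
    then show ?thesis using Nil idx_ge[of ys] by (auto split: if_splits)
  qed simp
next
  case (snoc b \<sigma>)
  show ?case
  proof (cases \<tau> rule: rev_cases)
    case Nil
    then show ?thesis using snoc.prems idx_ge[of \<sigma>] by (auto split: if_splits)
  next
    case (snoc ys y)
    then have "idx \<sigma> = idx ys \<and> b = y"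
      using snoc.prems by (auto split: if_splits) presburger+
    then show ?thesis using snoc.IH snoc by blast
  qed
qed

lemma length_le_iff_idx: "length \<sigma> \<le> K \<longleftrightarrow> idx \<sigma> < 2 * 2 ^ K"
proof
  assume "length \<sigma> \<le> K"
  then have "(2::nat) ^ length \<sigma> \<le> 2 ^ K" by (simp add: power_increasing)
  then show "idx \<sigma> < 2 * 2 ^ K" using idx_less[of \<sigma>] by linarith
next
  assume "idx \<sigma> < 2 * 2 ^ K"
  then have "(2::nat) ^ length \<sigma> < 2 ^ Suc K" using idx_ge[of \<sigma>] by simp
  then have "length \<sigma> < Suc K" by (rule power_less_imp_less_exp[rotated]) simp
  then show "length \<sigma> \<le> K" by simp
qed

text \<open>Halving a heap number moves to the parent. In this way \<open>dominates\<close> reaches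
  the ancestor at level \<open>m\<close>.\<close>

lemma idx_append_div: "idx (\<rho> @ \<tau>) div 2 ^ length \<tau> = idx \<rho>"
proof (induction \<tau> rule: rev_induct)
  case (snoc b \<tau>)
  have "idx (\<rho> @ \<tau> @ [b]) div 2 ^ length (\<tau> @ [b]) = idx ((\<rho> @ \<tau>) @ [b]) div 2 div 2 ^ length \<tau>"
    by (simp add: div_mult2_eq)
  also have "\<dots> = idx \<rho>" unfolding idx_snoc using snoc by simp
  finally show ?case .
qed simp

definition str :: "nat \<Rightarrow> bool list" where
  "str j = (SOME \<sigma>. idx \<sigma> = j)"

lemma str_idx [simp]: "str (idx \<sigma>) = \<sigma>"
  unfolding str_def by (rule some_equality) (auto dest: idx_inj)

lemma idx_str: "0 < j \<Longrightarrow> idx (str j) = j"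
  using idx_surj str_idx by metis

text \<open>Passes from the list codes by which \<open>mart_oracle\<close> addresses strings to heap
  numbers; as there, every nonzero entry counts as the bit \<open>True\<close>.\<close>

definition code_idx :: "nat \<Rightarrow> nat" where
  "code_idx c = idx (map (\<lambda>x. x \<noteq> 0) (list_decode c))"

lemma comp_fun_code_idx: "comp_fun k F \<Longrightarrow> comp_fun k (\<lambda>v. code_idx (F v))"
proof (rule comp_fun_comp1[where f = code_idx])
  \<comment> \<open>\<open>rest n c\<close> codes the list without its first \<open>n\<close>
    entries, 0 being the code of the empty list; \<open>acc n c\<close> is the heap number of those
    entries.\<close>
  define rest where "rest n c = rec_nat c (\<lambda>_ r. if r = 0 then 0 else snd (prod_decode (r - 1))) n" for n c :: nat
  define acc where "acc n c = rec_nat (1::nat) (\<lambda>n r. if rest n c = 0 then r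
      else 2 * r + (if fst (prod_decode (rest n c - 1)) = 0 then 0 else 1)) n" for n c :: nat
  have "comp_fun 2 (\<lambda>v. rest (v 0) (v 1))"
    unfolding rest_def
    by (intro comp_fun_rec comp_fun_if decidable_zero comp_fun_snd_prod_decode comp_fun_pred comp_fun_var comp_fun_const) auto
  note comp_fun_rest = comp_fun_comp2[OF this]
  have comp_fun_acc: "comp_fun 1 (\<lambda>v. acc (v 0) (v 0))"
    unfolding acc_def
    by (intro comp_fun_rec comp_fun_if decidable_zero comp_fun_fst_prod_decode comp_fun_pred
        comp_fun_rest comp_fun_add comp_fun_mult comp_fun_var comp_fun_const) auto
  have rest: "rest n c = list_encode (drop n (list_decode c))" for n c
  proof (induction n)
    case (Suc n)
    show ?case
    proof (cases "drop n (list_decode c)")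
      case Nil
      then have "drop (Suc n) (list_decode c) = []" by simp
      with Nil Suc show ?thesis by (simp add: rest_def)
    next
      case (Cons x xs)
      then have "drop (Suc n) (list_decode c) = xs" by (metis drop_Suc list.sel(3) tl_drop)
      with Cons Suc show ?thesis by (simp add: rest_def)
    qed
  qed (simp add: rest_def)
  have acc: "acc n c = idx (map (\<lambda>x. x \<noteq> 0) (take n (list_decode c)))" for n c
  proof (induction n)
    case 0
    show ?case by (simp add: acc_def)
  next
    case (Suc n)
    have step: "acc (Suc n) c = (if rest n c = 0 then acc n c
      else 2 * acc n c + (if fst (prod_decode (rest n c - 1)) = 0 then 0 else 1))"
      by (simp add: acc_def)
    show ?case
    proof (cases "n < length (list_decode c)")
      case True
      then have "drop n (list_decode c) = list_decode c ! n # drop (Suc n) (list_decode c)"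
        by (simp add: Cons_nth_drop_Suc)
      then have "rest n c = Suc (prod_encode (list_decode c ! n, list_encode (drop (Suc n) (list_decode c))))"
        by (simp add: rest)
      then show ?thesis using True Suc by (simp add: step take_Suc_conv_app_nth)
    next
      case False
      then have "rest n c = 0" by (simp add: rest)
      then show ?thesis using False Suc by (simp add: step)
    qed
  qed
  \<comment> \<open>A list is no longer than its code, so \<open>c\<close> rounds exhaust the list
    coded by \<open>c\<close>.\<close>
  have "length xs \<le> list_encode xs" for xs
  proof (induction xs)
    case (Cons x xs)
    then show ?case using le_prod_encode_2[of "list_encode xs" x] by simp
  qed simp
  from this[of "list_decode c" for c] have "acc c c = code_idx c" for c
    by (simp add: acc code_idx_def)
  with comp_fun_acc show "comp_fun 1 (\<lambda>v. code_idx (v 0))" by simp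
qed

text \<open>
  The oracle of a martingale whose value at the node \<open>j\<close> is \<open>digit b t j / 2 ^ P\<close>, defined for strings
  of length at most \<open>K\<close>.
\<close>

definition table_oracle :: "nat \<Rightarrow> nat \<Rightarrow> nat \<Rightarrow> nat \<Rightarrow> nat \<Rightarrow> nat" where
  "table_oracle P K b t x =
    (if code_idx (fst (prod_decode x)) < 2 * 2 ^ K
     then Suc (if snd (prod_decode x) = 0 then digit b t (code_idx (fst (prod_decode x))) div 2 ^ P
       else (2 ^ snd (prod_decode x) * digit b t (code_idx (fst (prod_decode x)))) div 2 ^ P mod 2)
     else 0)"

lemma comp_fun_table_oracle:
  assumes "comp_fun k P" "comp_fun k K" "comp_fun k b" "comp_fun k t" "comp_fun k x"
  shows "comp_fun k (\<lambda>v. table_oracle (P v) (K v) (b v) (t v) (x v))"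
  unfolding table_oracle_def
  by (intro comp_fun_if decidable_zero decidable_less comp_fun_Suc comp_fun_div comp_fun_mod
      comp_fun_digit comp_fun_code_idx comp_fun_fst_prod_decode
      comp_fun_snd_prod_decode comp_fun_mult comp_fun_power comp_fun_const assms)

lemma comp_fun_sim_table:
  assumes "comp_fun k P" "comp_fun k K" "comp_fun k b" "comp_fun k t" "comp_fun k u" "comp_fun k n"
  shows "comp_fun k (\<lambda>v. sim e (table_oracle (P v) (K v) (b v) (t v)) (u v) [n v])"
proof -
  define L where "L \<pi> = table_oracle (\<pi> ! 0) (\<pi> ! 1) (\<pi> ! 2) (\<pi> ! 3)" for \<pi>
  have "comp_fun k (\<lambda>v. sim e (L (map (\<lambda>p. p v) [P, K, b, t])) (u v) (map (\<lambda>G. G v) [n]))"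
  proof (rule comp_fun_sim[where N = 4])
    fix k and \<pi> :: "((nat \<Rightarrow> nat) \<Rightarrow> nat) list" and x
    assume *: "\<forall>p \<in> set \<pi>. comp_fun k p" "length \<pi> = 4" "comp_fun k x"
    have "comp_fun k (\<lambda>v. table_oracle ((\<pi> ! 0) v) ((\<pi> ! 1) v) ((\<pi> ! 2) v) ((\<pi> ! 3) v) (x v))"
      using * by (intro comp_fun_table_oracle) auto
    then show "comp_fun k (\<lambda>v. L (map (\<lambda>p. p v) \<pi>) (x v))"
      using *(2) by (simp add: L_def)
  qed (use assms in auto)
  then show ?thesis by (simp add: L_def)
qed

text \<open>Floors of dyadic rationals are integer quotients, so the integer part and the binary
  digits come out exactly from the numerators.\<close>

lemma table_oracle_eq:
  assumes "\<And>\<sigma>. length \<sigma> \<le> K \<Longrightarrow> S \<sigma> = real (digit b t (idx \<sigma>)) / 2 ^ P"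
  shows "table_oracle P K b t x =
    (if length (list_decode (fst (prod_decode x))) \<le> K then Suc (mart_oracle S x) else 0)"
proof -
  obtain c k where x: "prod_decode x = (c, k)" by fastforce
  define \<rho> where "\<rho> = map (\<lambda>x. x \<noteq> 0) (list_decode c)"
  define A where "A = digit b t (idx \<rho>)"
  have len: "length \<rho> = length (list_decode c)" by (simp add: \<rho>_def)
  have ci: "code_idx c = idx \<rho>" by (simp only: code_idx_def \<rho>_def)
  show ?thesis
  proof (cases "length \<rho> \<le> K")
    case True
    have "S \<rho> = real A / 2 ^ P" using assms True by (simp add: A_def)
    then have "\<lfloor>2 ^ j * S \<rho>\<rfloor> = int (2 ^ j * A div 2 ^ P)" for j
      using floor_divide_of_nat_eq[of "2 ^ j * A" "2 ^ P", where ?'a = real] by simp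
    note fl = this
    have mo: "mart_oracle S x = (if k = 0 then nat \<lfloor>S \<rho>\<rfloor> else nat (\<lfloor>2 ^ k * S \<rho>\<rfloor> mod 2))"
      by (simp only: mart_oracle_def x case_prod_conv Let_def \<rho>_def)
    have md: "nat (int q mod 2) = q mod 2" for q by (simp add: nat_mod_distrib)
    have "mart_oracle S x = (if k = 0 then A div 2 ^ P else 2 ^ k * A div 2 ^ P mod 2)"
      using fl[of 0] by (simp only: mo fl md power_0 mult_1 nat_int)
    moreover have "idx \<rho> < 2 * 2 ^ K" using True length_le_iff_idx by blast
    ultimately show ?thesis
      using True len by (simp add: table_oracle_def x ci A_def)
  next
    case False
    then have "\<not> idx \<rho> < 2 * 2 ^ K" using length_le_iff_idx by blast
    then show ?thesis
      using False len by (simp add: table_oracle_def x ci)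
  qed
qed

text \<open>
  A table \<open>v\<close> stands for the supermartingale with value \<open>v j / 4 ^ l\<close> at the node \<open>j\<close> of level \<open>l\<close>,
  whence the factor 8; \<open>d\<close> bounds it at level \<open>m\<close>. As \<open>4 ^ l \<le> j * j\<close>, the first clause is a
  uniform bound.
\<close>

definition valid_table :: "nat \<Rightarrow> (nat \<Rightarrow> nat) \<Rightarrow> nat \<Rightarrow> (nat \<Rightarrow> nat) \<Rightarrow> nat \<Rightarrow> bool" where
  "valid_table m d B v s \<longleftrightarrow>
    (\<forall>j < s. v j \<le> B * (j * j)) \<and>
    (\<forall>j < s. 2 ^ m \<le> j \<and> 2 * j + 1 < s \<longrightarrow> v (2 * j) + v (2 * j + 1) \<le> 8 * v j) \<and>
    (\<forall>j < s. 2 ^ m \<le> j \<and> j < 2 * 2 ^ m \<longrightarrow> v j \<le> d j)"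

text \<open>
  \<open>A j / 2 ^ (p + P)\<close> is a martingale up to level \<open>K\<close> which extends \<open>a j / 2 ^ p\<close> and, above a node
  \<open>\<rho>\<close> of level \<open>m\<close>, is at least \<open>c \<rho> / 2 ^ p\<close> plus the supermartingale of \<open>v\<close>.
\<close>

definition dominates ::
    "nat \<Rightarrow> nat \<Rightarrow> (nat \<Rightarrow> nat) \<Rightarrow> (nat \<Rightarrow> nat) \<Rightarrow> nat \<Rightarrow> nat \<Rightarrow> (nat \<Rightarrow> nat) \<Rightarrow> (nat \<Rightarrow> nat) \<Rightarrow> bool" where
  "dominates m p a c P K A v \<longleftrightarrow> m \<le> K \<and>
    (\<forall>j < 2 * 2 ^ m. 0 < j \<longrightarrow> A j = a j * 2 ^ P) \<and>
    (\<forall>j < 2 ^ K. 0 < j \<longrightarrow> 2 * A j = A (2 * j) + A (2 * j + 1)) \<and>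
    (\<forall>l < Suc K. m \<le> l \<longrightarrow> (\<forall>r < 2 ^ l.
      2 ^ P * (c ((2 ^ l + r) div 2 ^ (l - m)) * 4 ^ l + v (2 ^ l + r) * 2 ^ p) \<le> A (2 ^ l + r) * 4 ^ l))"

text \<open>The forcing question with all searches cut off at \<open>s\<close>. The base exceeds
  every entry that a valid table may have, so \<open>w\<close> runs through all valid tables of
  length \<open>s\<close>; \<open>2 * 2 ^ K \<le> s\<close> puts all nodes up to level
  \<open>K\<close> inside the table.\<close>

definition covered ::
    "recf \<Rightarrow> nat \<Rightarrow> nat \<Rightarrow> (nat \<Rightarrow> nat) \<Rightarrow> (nat \<Rightarrow> nat) \<Rightarrow> (nat \<Rightarrow> nat) \<Rightarrow> nat \<Rightarrow> nat \<Rightarrow> nat \<Rightarrow> nat \<Rightarrow> bool" where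
  "covered e m p d a c B i s n \<longleftrightarrow>
    (\<forall>w < (B * (s * s) + 1) ^ s. valid_table m d B (digit (B * (s * s) + 1) w) s \<longrightarrow>
      (\<exists>P < s. \<exists>K < s. \<exists>b < s. \<exists>t < s. \<exists>u < s. 2 * 2 ^ K \<le> s \<and>
        dominates m p a c P K (digit b t) (digit (B * (s * s) + 1) w) \<and>
        sim e (table_oracle (p + P) K b t) u [n] = Suc i))"

lemma decidable_covered:
  assumes "\<And>k F. comp_fun k F \<Longrightarrow> comp_fun k (\<lambda>v. d (F v))" "\<And>k F. comp_fun k F \<Longrightarrow> comp_fun k (\<lambda>v. a (F v))"
    "\<And>k F. comp_fun k F \<Longrightarrow> comp_fun k (\<lambda>v. c (F v))"
  shows "decidable 2 (\<lambda>v. covered e m p d a c B i (v 0) (v 1))"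
  unfolding covered_def valid_table_def dominates_def
  by (intro decidable_basic comp_fun_arith comp_fun_div comp_fun_digit
      comp_fun_sim_table assms comp_fun_var comp_fun_const) simp_all

section \<open>Martingales\<close>

text \<open>Dependent choice along the binary tree; both children are picked at once because
  \<open>R\<close> ties them to their parent.\<close>

lemma tree_choice:
  fixes P :: "bool list \<Rightarrow> 'a \<Rightarrow> bool"
  assumes "P [] x0"
    and "\<And>\<sigma> x. P \<sigma> x \<Longrightarrow> \<exists>y z. P (\<sigma> @ [False]) y \<and> P (\<sigma> @ [True]) z \<and> R \<sigma> x y z"
  shows "\<exists>F. \<forall>\<sigma>. P \<sigma> (F \<sigma>) \<and> R \<sigma> (F \<sigma>) (F (\<sigma> @ [False])) (F (\<sigma> @ [True]))"
proof -
  have "\<forall>\<sigma> x. \<exists>y z. P \<sigma> x \<longrightarrow> P (\<sigma> @ [False]) y \<and> P (\<sigma> @ [True]) z \<and> R \<sigma> x y z"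
    using assms(2) by blast
  then obtain f g where fg: "\<And>\<sigma> x. P \<sigma> x \<Longrightarrow>
      P (\<sigma> @ [False]) (f \<sigma> x) \<and> P (\<sigma> @ [True]) (g \<sigma> x) \<and> R \<sigma> x (f \<sigma> x) (g \<sigma> x)"
    by metis
  \<comment> \<open>The node travels along with the value, since the choice functions depend on
    it.\<close>
  define st where "st = foldl (\<lambda>(\<tau>, x) b. (\<tau> @ [b], if b then g \<tau> x else f \<tau> x)) ([], x0)"
  have st_snoc: "st (\<sigma> @ [b]) = (\<lambda>(\<tau>, x). (\<tau> @ [b], if b then g \<tau> x else f \<tau> x)) (st \<sigma>)" for \<sigma> b
    by (simp add: st_def split_beta)
  have fst_st: "fst (st \<sigma>) = \<sigma>" for \<sigma>
    by (induction \<sigma> rule: rev_induct) (simp add: st_def, simp add: st_snoc split_beta)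
  define F where "F = snd \<circ> st"
  have F: "F (\<sigma> @ [b]) = (if b then g \<sigma> (F \<sigma>) else f \<sigma> (F \<sigma>))" for \<sigma> b
    by (simp add: F_def st_snoc split_beta fst_st)
  have "P \<sigma> (F \<sigma>)" for \<sigma>
  proof (induction \<sigma> rule: rev_induct)
    case Nil
    show ?case using assms(1) by (simp add: F_def st_def)
  next
    case (snoc b \<sigma>)
    then show ?case using fg by (simp add: F)
  qed
  then show ?thesis using fg by (intro exI[of _ F]) (auto simp: F)
qed

section \<open>Conditional expectations on the binary tree\<close>

primrec avg :: "nat \<Rightarrow> (bool list \<Rightarrow> real) \<Rightarrow> bool list \<Rightarrow> real" where
  "avg 0 F \<sigma> = F \<sigma>"
| "avg (Suc k) F \<sigma> = (avg k F (\<sigma> @ [False]) + avg k F (\<sigma> @ [True])) / 2"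

lemma avg_mono: "(\<And>\<tau>. length \<tau> = length \<sigma> + k \<Longrightarrow> F \<tau> \<le> G \<tau>) \<Longrightarrow> avg k F \<sigma> \<le> avg k G \<sigma>"
proof (induction k arbitrary: \<sigma>)
  case (Suc k)
  have "avg k F (\<sigma> @ [b]) \<le> avg k G (\<sigma> @ [b])" for b
    by (rule Suc.IH) (use Suc.prems in auto)
  then show ?case by (simp add: add_mono divide_right_mono)
qed simp

lemma avg_cong: "(\<And>\<tau>. length \<tau> = length \<sigma> + k \<Longrightarrow> F \<tau> = G \<tau>) \<Longrightarrow> avg k F \<sigma> = avg k G \<sigma>"
  by (simp add: avg_mono eq_iff)

lemma avg_const: "avg k (\<lambda>_. c) \<sigma> = c"
  by (induction k arbitrary: \<sigma>) auto

lemma avg_affine: "avg k (\<lambda>\<tau>. c + (F \<tau> - G \<tau>) / d) \<sigma> = c + (avg k F \<sigma> - avg k G \<sigma>) / d"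
proof (induction k arbitrary: \<sigma>)
  case (Suc k)
  show ?case unfolding avg.simps Suc by (simp add: add_divide_distrib diff_divide_distrib)
qed simp

lemma avg_eq:
  assumes "\<And>\<tau>. length \<sigma> \<le> length \<tau> \<Longrightarrow> 2 * F \<tau> = F (\<tau> @ [False]) + F (\<tau> @ [True])"
  shows "avg k F \<sigma> = F \<sigma>"
  using assms
proof (induction k arbitrary: \<sigma>)
  case (Suc k)
  have "avg k F (\<sigma> @ [b]) = F (\<sigma> @ [b])" for b
    by (rule Suc.IH) (use Suc.prems in auto)
  then show ?case using Suc.prems[of \<sigma>] by simp
qed simp

lemma martingale_nonneg: "martingale S \<Longrightarrow> 0 \<le> S \<sigma>"
  by (simp add: martingale_def)

lemma martingale_step: "martingale S \<Longrightarrow> S \<sigma> = (S (\<sigma> @ [False]) + S (\<sigma> @ [True])) / 2"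
  unfolding martingale_def by (metis nonzero_mult_div_cancel_left zero_neq_numeral)

lemma avg_martingale: "martingale S \<Longrightarrow> avg k S \<sigma> = S \<sigma>"
  by (rule avg_eq) (simp add: martingale_def)

text \<open>Tower property: the longest strings are averaged first, whereas the definition splits at
  the root of the subtree.\<close>

lemma avg_Suc_right: "avg (Suc k) F \<sigma> = avg k (avg 1 F) \<sigma>"
proof (induction k arbitrary: \<sigma>)
  case (Suc k)
  show ?case unfolding avg.simps(2)[of "Suc k"] Suc avg.simps(2)[of k "avg 1 F"] ..
qed simp

text \<open>Each value is the average of the values above it on level \<open>m\<close>.\<close>

lemma martingale_le_below:
  assumes "martingale U" "martingale S" "\<And>\<sigma>. length \<sigma> = m \<Longrightarrow> U \<sigma> \<le> S \<sigma>" "length \<sigma> \<le> m"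
  shows "U \<sigma> \<le> S \<sigma>"
  using avg_mono[of \<sigma> "m - length \<sigma>" U S] assms by (simp add: avg_martingale)

text \<open>By nonnegativity a child has at most twice the value of its parent.\<close>

lemma martingale_le_root:
  assumes "martingale S"
  shows "S \<sigma> \<le> 2 ^ length \<sigma> * S []"
proof (induction \<sigma> rule: rev_induct)
  case (snoc b \<sigma>)
  have "2 * S \<sigma> = S (\<sigma> @ [False]) + S (\<sigma> @ [True])" "0 \<le> S (\<sigma> @ [False])" "0 \<le> S (\<sigma> @ [True])"
    using assms by (auto simp: martingale_def)
  then have "S (\<sigma> @ [b]) \<le> 2 * S \<sigma>" by (cases b) auto
  with snoc show ?case by simp
qed simp

text \<open>For functions that are constructed from level \<open>m\<close> on: shorter strings
  receive the average over level \<open>m\<close>.\<close>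

definition extend_down :: "nat \<Rightarrow> (bool list \<Rightarrow> real) \<Rightarrow> bool list \<Rightarrow> real" where
  "extend_down m F \<sigma> = avg (m - length \<sigma>) F \<sigma>"

lemma extend_down_eq: "m \<le> length \<sigma> \<Longrightarrow> extend_down m F \<sigma> = F \<sigma>"
  by (simp add: extend_down_def)

lemma martingale_extend_down:
  assumes "\<And>\<sigma>. m \<le> length \<sigma> \<Longrightarrow> 0 \<le> F \<sigma>"
    and "\<And>\<sigma>. m \<le> length \<sigma> \<Longrightarrow> 2 * F \<sigma> = F (\<sigma> @ [False]) + F (\<sigma> @ [True])"
  shows "martingale (extend_down m F)"
  unfolding martingale_def
proof (intro conjI allI)
  fix \<sigma>
  show "0 \<le> extend_down m F \<sigma>"
    unfolding extend_down_def
    using avg_mono[of \<sigma> "m - length \<sigma>" "\<lambda>_. 0" F] assms(1) by (simp add: avg_const)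
  show "2 * extend_down m F \<sigma> = extend_down m F (\<sigma> @ [False]) + extend_down m F (\<sigma> @ [True])"
  proof (cases "m \<le> length \<sigma>")
    case True
    then show ?thesis using assms(2) by (simp add: extend_down_eq)
  next
    case False
    then have "m - length \<sigma> = Suc (m - Suc (length \<sigma>))" by simp
    then show ?thesis by (simp add: extend_down_def)
  qed
qed

lemma extend_down_le:
  assumes "\<And>\<sigma>. m \<le> length \<sigma> \<Longrightarrow> F \<sigma> \<le> B"
  shows "extend_down m F \<sigma> \<le> B"
  unfolding extend_down_def
  using avg_mono[of \<sigma> "m - length \<sigma>" F "\<lambda>_. B"] assms by (simp add: avg_const)

lemma bounded_martingaleI: "martingale S \<Longrightarrow> (\<And>\<sigma>. S \<sigma> \<le> B) \<Longrightarrow> bounded_fun S"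
  unfolding bounded_fun_def by (metis abs_of_nonneg martingale_nonneg)

lemma martingale_add: "martingale S \<Longrightarrow> martingale U \<Longrightarrow> martingale (\<lambda>\<sigma>. S \<sigma> + U \<sigma>)"
  by (fastforce simp: martingale_def)

lemma bounded_fun_add: "bounded_fun S \<Longrightarrow> bounded_fun U \<Longrightarrow> bounded_fun (\<lambda>\<sigma>. S \<sigma> + U \<sigma>)"
  unfolding bounded_fun_def by (metis abs_triangle_ineq add_mono order_trans)

text \<open>By convexity the averaged squares increase; being bounded they converge, and shifting
  the limit by one level shows that it is again fair. Convergence at the root expresses convergence
  of \<open>U\<close> in L2.\<close>

lemma martingale_square_limit:
  assumes U: "martingale U" and B: "\<And>\<sigma>. U \<sigma> \<le> B"
  obtains X where "\<And>\<sigma>. (U \<sigma>)\<^sup>2 \<le> X \<sigma>" "\<And>\<sigma>. X \<sigma> \<le> B\<^sup>2"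
    "\<And>\<sigma>. 2 * X \<sigma> = X (\<sigma> @ [False]) + X (\<sigma> @ [True])"
    "(\<lambda>k. avg k (\<lambda>\<tau>. (U \<tau>)\<^sup>2) []) \<longlonglongrightarrow> X []"
proof -
  let ?Q = "\<lambda>\<tau>. (U \<tau>)\<^sup>2"
  define X where "X \<sigma> = lim (\<lambda>k. avg k ?Q \<sigma>)" for \<sigma>
  have Q1: "?Q \<tau> \<le> avg 1 ?Q \<tau>" for \<tau>
  proof -
    define x y where "x = U (\<tau> @ [False])" and "y = U (\<tau> @ [True])"
    have "U \<tau> = (x + y) / 2" using martingale_step[OF U] by (simp add: x_def y_def)
    moreover have "avg 1 ?Q \<tau> = (x\<^sup>2 + y\<^sup>2) / 2" by (simp add: x_def y_def)
    ultimately have "avg 1 ?Q \<tau> - ?Q \<tau> = (x\<^sup>2 + y\<^sup>2) / 2 - ((x + y) / 2)\<^sup>2" by (simp only:)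
    also have "\<dots> = ((x - y) / 2)\<^sup>2"
      by (simp add: power2_eq_square add_divide_distrib diff_divide_distrib algebra_simps)
    finally have "avg 1 ?Q \<tau> - ?Q \<tau> = ((x - y) / 2)\<^sup>2" .
    then show ?thesis by (metis diff_ge_0_iff_ge zero_le_power2)
  qed
  have inc: "incseq (\<lambda>k. avg k ?Q \<sigma>)" for \<sigma>
  proof (rule incseq_SucI)
    fix k
    show "avg k ?Q \<sigma> \<le> avg (Suc k) ?Q \<sigma>"
      unfolding avg_Suc_right by (rule avg_mono) (rule Q1)
  qed
  have "?Q \<tau> \<le> B\<^sup>2" for \<tau>
    using B[of \<tau>] U by (simp add: martingale_def power_mono)
  then have bd: "avg k ?Q \<sigma> \<le> B\<^sup>2" for k \<sigma>
    using avg_mono[of \<sigma> k ?Q "\<lambda>_. B\<^sup>2"] by (simp add: avg_const)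
  have "convergent (\<lambda>k. avg k ?Q \<sigma>)" for \<sigma>
    using incseq_convergent[OF inc, of \<sigma> "B\<^sup>2"] bd by (metis convergentI)
  then have lim: "(\<lambda>k. avg k ?Q \<sigma>) \<longlonglongrightarrow> X \<sigma>" for \<sigma>
    unfolding X_def by (simp add: convergent_LIMSEQ_iff)
  have "?Q \<sigma> \<le> X \<sigma>" for \<sigma>
    using incseq_le[OF inc lim, of 0 \<sigma>] by simp
  moreover have "X \<sigma> \<le> B\<^sup>2" for \<sigma>
    using LIMSEQ_le_const2[OF lim] bd by blast
  moreover have "2 * X \<sigma> = X (\<sigma> @ [False]) + X (\<sigma> @ [True])" for \<sigma>
  proof -
    have "(\<lambda>k. avg (Suc k) ?Q \<sigma>) \<longlonglongrightarrow> X \<sigma>"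
      using lim by (rule LIMSEQ_Suc)
    moreover have "(\<lambda>k. avg (Suc k) ?Q \<sigma>) \<longlonglongrightarrow> (X (\<sigma> @ [False]) + X (\<sigma> @ [True])) / 2"
      using lim by (auto intro!: tendsto_intros)
    ultimately have "X \<sigma> = (X (\<sigma> @ [False]) + X (\<sigma> @ [True])) / 2"
      by (rule LIMSEQ_unique)
    then show ?thesis by simp
  qed
  ultimately show ?thesis using that lim by blast
qed

text \<open>Once the averaged squares at the root are within \<open>\<epsilon>\<^sup>2\<close> of
  their limit, the mean square oscillation of \<open>U\<close> above level \<open>m\<close> is below
  \<open>\<epsilon>\<^sup>2\<close>.\<close>

lemma small_oscillation:
  assumes U: "martingale U" "bounded_fun U" and "0 < \<epsilon>"
  shows "\<exists>N. \<forall>m \<ge> N. \<exists>D. martingale D \<and> bounded_fun D \<and> D [] \<le> \<epsilon> \<and>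
    (\<forall>\<sigma>. m \<le> length \<sigma> \<longrightarrow> U \<sigma> \<le> U (take m \<sigma>) + D \<sigma>)"
proof -
  obtain B where B: "\<And>\<sigma>. \<bar>U \<sigma>\<bar> \<le> B" using U(2) by (auto simp: bounded_fun_def)
  then have B': "\<And>\<sigma>. U \<sigma> \<le> B" using abs_le_D1 by blast
  obtain X where X: "\<And>\<sigma>. (U \<sigma>)\<^sup>2 \<le> X \<sigma>" "\<And>\<sigma>. X \<sigma> \<le> B\<^sup>2"
    "\<And>\<sigma>. 2 * X \<sigma> = X (\<sigma> @ [False]) + X (\<sigma> @ [True])"
    "(\<lambda>k. avg k (\<lambda>\<tau>. (U \<tau>)\<^sup>2) []) \<longlonglongrightarrow> X []"
    using martingale_square_limit[OF U(1) B'] by blast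
  obtain N where N: "\<And>m. m \<ge> N \<Longrightarrow> \<bar>avg m (\<lambda>\<tau>. (U \<tau>)\<^sup>2) [] - X []\<bar> < \<epsilon>\<^sup>2"
    using LIMSEQ_D[OF X(4), of "\<epsilon>\<^sup>2"] \<open>0 < \<epsilon>\<close> by auto
  show ?thesis
  proof (intro exI[of _ N] allI impI)
    fix m assume "N \<le> m"
    \<comment> \<open>From \<open>x \<le> \<epsilon> / 2 + x\<^sup>2 / (2 * \<epsilon>)\<close> with \<open>x = \<bar>U \<sigma> - U \<rho>\<bar>\<close>, replacing \<open>(U \<sigma>)\<^sup>2\<close> by the martingale \<open>X\<close>.\<close>
    define E where "E \<sigma> = \<epsilon> / 2 + (X \<sigma> - (2 * U \<sigma> * U (take m \<sigma>) - (U (take m \<sigma>))\<^sup>2)) / (2 * \<epsilon>)" for \<sigma>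
    have E_ge: "\<bar>U \<sigma> - U (take m \<sigma>)\<bar> \<le> E \<sigma>" for \<sigma>
    proof -
      define x where "x = \<bar>U \<sigma> - U (take m \<sigma>)\<bar>"
      have "0 \<le> (\<epsilon> - x)\<^sup>2" by simp
      then have "x * (2 * \<epsilon>) \<le> \<epsilon> * \<epsilon> + x\<^sup>2" by (simp add: power2_eq_square algebra_simps)
      then have "x \<le> \<epsilon> / 2 + x\<^sup>2 / (2 * \<epsilon>)" using \<open>0 < \<epsilon>\<close> by (simp add: field_simps power2_eq_square)
      also have "x\<^sup>2 = (U \<sigma>)\<^sup>2 - (2 * U \<sigma> * U (take m \<sigma>) - (U (take m \<sigma>))\<^sup>2)"
        by (simp add: x_def power2_eq_square algebra_simps)
      also have "\<epsilon> / 2 + \<dots> / (2 * \<epsilon>) \<le> E \<sigma>"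
        unfolding E_def using X(1)[of \<sigma>] \<open>0 < \<epsilon>\<close> by (intro add_left_mono divide_right_mono) auto
      finally show ?thesis by (simp add: x_def)
    qed
    \<comment> \<open>Above level \<open>m\<close> the value \<open>U (take m \<sigma>)\<close> is
      constant, so \<open>E\<close> is affine in \<open>X\<close> and \<open>U\<close>
      there.\<close>
    have E_mart: "2 * E \<sigma> = E (\<sigma> @ [False]) + E (\<sigma> @ [True])" if "m \<le> length \<sigma>" for \<sigma>
    proof -
      define u where "u = U (take m \<sigma>)"
      have t: "take m (\<sigma> @ [b]) = take m \<sigma>" for b using that by simp
      show ?thesis
        unfolding E_def t u_def[symmetric] martingale_step[OF U(1), of \<sigma>]
        using X(3)[of \<sigma>] \<open>0 < \<epsilon>\<close> by (simp add: field_simps)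
    qed
    have E_bd: "E \<sigma> \<le> \<epsilon> / 2 + (2 * B\<^sup>2) / (2 * \<epsilon>)" for \<sigma>
    proof -
      have "0 \<le> U \<sigma> * U (take m \<sigma>)" using U(1) by (simp add: martingale_nonneg)
      moreover have "(U (take m \<sigma>))\<^sup>2 \<le> B\<^sup>2" using X(1,2) order_trans by blast
      ultimately have "X \<sigma> - (2 * U \<sigma> * U (take m \<sigma>) - (U (take m \<sigma>))\<^sup>2) \<le> 2 * B\<^sup>2"
        using X(2)[of \<sigma>] by simp
      then show ?thesis unfolding E_def using \<open>0 < \<epsilon>\<close> by (intro add_left_mono divide_right_mono) auto
    qed
    have E_nonneg: "0 \<le> E \<sigma>" for \<sigma> using E_ge[of \<sigma>] by linarith
    let ?D = "extend_down m E"
    have "martingale ?D" using E_nonneg E_mart by (rule martingale_extend_down)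
    moreover have "bounded_fun ?D"
      using \<open>martingale ?D\<close> extend_down_le[OF E_bd] by (rule bounded_martingaleI)
    moreover have "?D [] \<le> \<epsilon>"
    proof -
      \<comment> \<open>On level \<open>m\<close> itself \<open>take m\<close> is the identity, and
        the subtracted term reduces to the square of \<open>U\<close>.\<close>
      have "?D [] = avg m (\<lambda>\<tau>. \<epsilon> / 2 + (X \<tau> - (U \<tau>)\<^sup>2) / (2 * \<epsilon>)) []"
        unfolding extend_down_def by (simp, rule avg_cong) (simp add: E_def power2_eq_square)
      also have "\<dots> = \<epsilon> / 2 + (X [] - avg m (\<lambda>\<tau>. (U \<tau>)\<^sup>2) []) / (2 * \<epsilon>)"
        unfolding avg_affine using avg_eq[of "[]" X m] X(3) by simp
      also have "\<dots> \<le> \<epsilon> / 2 + \<epsilon>\<^sup>2 / (2 * \<epsilon>)"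
        using N[OF \<open>N \<le> m\<close>] \<open>0 < \<epsilon>\<close> by (intro add_left_mono divide_right_mono) auto
      also have "\<dots> = \<epsilon>" using \<open>0 < \<epsilon>\<close> by (simp add: power2_eq_square)
      finally show ?thesis .
    qed
    moreover have "U \<sigma> \<le> U (take m \<sigma>) + ?D \<sigma>" if "m \<le> length \<sigma>" for \<sigma>
      using E_ge[of \<sigma>] that by (simp add: extend_down_eq)
    ultimately show "\<exists>D. martingale D \<and> bounded_fun D \<and> D [] \<le> \<epsilon> \<and>
      (\<forall>\<sigma>. m \<le> length \<sigma> \<longrightarrow> U \<sigma> \<le> U (take m \<sigma>) + D \<sigma>)" by blast
  qed
qed

text \<open>The deficit at a node can be handed to its children without passing the ceiling
  \<open>B\<close>: a parent value of at most \<open>B\<close> needs at most \<open>2 * B\<close>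
  from the two together.\<close>

lemma bounded_supermartingale_majorant:
  assumes "\<And>\<sigma>. m \<le> length \<sigma> \<Longrightarrow> 0 \<le> V \<sigma>" and "\<And>\<sigma>. m \<le> length \<sigma> \<Longrightarrow> V \<sigma> \<le> B"
    and "\<And>\<sigma>. m \<le> length \<sigma> \<Longrightarrow> V (\<sigma> @ [False]) + V (\<sigma> @ [True]) \<le> 2 * V \<sigma>"
  shows "\<exists>M. martingale M \<and> bounded_fun M \<and> (\<forall>\<sigma>. m \<le> length \<sigma> \<longrightarrow> V \<sigma> \<le> M \<sigma>) \<and>
    (\<forall>\<sigma>. length \<sigma> = m \<longrightarrow> M \<sigma> = V \<sigma>)"
proof -
  \<comment> \<open>Values below level \<open>m\<close> are placeholders, which
    \<open>extend_down\<close> replaces by averages.\<close>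
  define P where "P \<sigma> x \<longleftrightarrow> (length \<sigma> \<le> m \<longrightarrow> x = V \<sigma>) \<and> (m \<le> length \<sigma> \<longrightarrow> V \<sigma> \<le> x \<and> x \<le> B)" for \<sigma> x
  have "\<exists>F. \<forall>\<sigma>. P \<sigma> (F \<sigma>) \<and> (m \<le> length \<sigma> \<longrightarrow> 2 * F \<sigma> = F (\<sigma> @ [False]) + F (\<sigma> @ [True]))"
  proof (rule tree_choice)
    show "P [] (V [])" using assms by (auto simp: P_def)
    fix \<sigma> x assume P: "P \<sigma> x"
    show "\<exists>y z. P (\<sigma> @ [False]) y \<and> P (\<sigma> @ [True]) z \<and> (m \<le> length \<sigma> \<longrightarrow> 2 * x = y + z)"
    proof (cases "m \<le> length \<sigma>")
      case False
      then show ?thesis using assms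
        by (intro exI[of _ "V (\<sigma> @ [False])"] exI[of _ "V (\<sigma> @ [True])"]) (auto simp: P_def)
    next
      case True
      \<comment> \<open>The surplus goes to the left child as far as \<open>B\<close> permits.\<close>
      define y where "y = min B (2 * x - V (\<sigma> @ [True]))"
      have "V \<sigma> \<le> x" "x \<le> B" using P True by (auto simp: P_def)
      then have "P (\<sigma> @ [False]) y" "P (\<sigma> @ [True]) (2 * x - y)"
        using assms(2)[of "\<sigma> @ [False]"] assms(2)[of "\<sigma> @ [True]"] assms(3)[of \<sigma>] True
        by (auto simp: P_def y_def)
      then show ?thesis by (intro exI[of _ y] exI[of _ "2 * x - y"]) auto
    qed
  qed
  then obtain F where F: "\<And>\<sigma>. P \<sigma> (F \<sigma>)"
    "\<And>\<sigma>. m \<le> length \<sigma> \<Longrightarrow> 2 * F \<sigma> = F (\<sigma> @ [False]) + F (\<sigma> @ [True])" by blast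
  have "martingale (extend_down m F)"
  proof (rule martingale_extend_down)
    show "0 \<le> F \<sigma>" if "m \<le> length \<sigma>" for \<sigma>
      using F(1)[of \<sigma>] assms(1)[OF that] that by (auto simp: P_def)
  qed (rule F(2))
  moreover have "bounded_fun (extend_down m F)"
    by (rule bounded_martingaleI[OF calculation extend_down_le[where B = B]]) (use F in \<open>auto simp: P_def\<close>)
  ultimately show ?thesis
    using F by (intro exI[of _ "extend_down m F"]) (auto simp: extend_down_eq P_def)
qed

section \<open>Dyadic rationals and dyadic-valued martingales\<close>

definition dyadic :: "real \<Rightarrow> bool" where
  "dyadic x \<longleftrightarrow> (\<exists>p n :: nat. x = real n / 2 ^ p)"

lemma dyadic_scale:
  assumes "dyadic x"
  shows "\<exists>q. \<forall>p \<ge> q. \<exists>n :: nat. x = real n / 2 ^ p"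
proof -
  obtain q n where x: "x = real n / 2 ^ q" using assms by (auto simp: dyadic_def)
  have "\<exists>n' :: nat. x = real n' / 2 ^ p" if "q \<le> p" for p
  proof
    have "(2::real) ^ p = 2 ^ q * 2 ^ (p - q)" using that by (simp flip: power_add)
    then show "x = real (n * 2 ^ (p - q)) / 2 ^ p" by (simp add: x)
  qed
  then show ?thesis by blast
qed

lemma dyadic_scale_finite:
  assumes "finite A" "\<And>x. x \<in> A \<Longrightarrow> dyadic (f x)"
  shows "\<exists>q. \<forall>p \<ge> q. \<forall>x \<in> A. \<exists>n :: nat. f x = real n / 2 ^ p"
  using assms
proof (induction A)
  case (insert a A)
  then obtain q where q: "\<forall>p \<ge> q. \<forall>x \<in> A. \<exists>n :: nat. f x = real n / 2 ^ p" by auto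
  obtain q' where "\<forall>p \<ge> q'. \<exists>n :: nat. f a = real n / 2 ^ p"
    using dyadic_scale insert.prems by blast
  with q show ?case by (intro exI[of _ "max q q'"]) auto
qed simp

lemma dyadic_nonneg: "dyadic x \<Longrightarrow> 0 \<le> x"
  by (auto simp: dyadic_def)

lemma dyadic_double_diff:
  assumes "dyadic x" "dyadic y" "y \<le> 2 * x"
  shows "dyadic (2 * x - y)"
proof -
  obtain q where "\<forall>p \<ge> q. \<forall>z \<in> {x, y}. \<exists>n :: nat. z = real n / 2 ^ p"
    using dyadic_scale_finite[of "{x, y}" "\<lambda>z. z"] assms by auto
  then obtain a b :: nat where ab: "x = real a / 2 ^ q" "y = real b / 2 ^ q" by auto
  then have "real b \<le> real (2 * a)" using assms(3) by (simp add: divide_le_cancel)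
  then have "2 * x - y = real (2 * a - b) / 2 ^ q" using ab by (simp add: of_nat_diff diff_divide_distrib)
  then show ?thesis unfolding dyadic_def by blast
qed

lemma dyadic_dense:
  assumes "0 \<le> a" "a < b"
  shows "\<exists>x. dyadic x \<and> a < x \<and> x < b"
proof -
  obtain p where p: "(1 / 2) ^ p < b - a"
    using real_arch_pow_inv[of "b - a" "1 / 2"] assms by auto
  \<comment> \<open>The least multiple of \<open>1 / 2 ^ p\<close> strictly above
    \<open>a\<close>.\<close>
  define n where "n = nat (\<lfloor>a * 2 ^ p\<rfloor> + 1)"
  have "real n = of_int \<lfloor>a * 2 ^ p\<rfloor> + 1" using assms by (simp add: n_def)
  then have "a * 2 ^ p < real n" "real n \<le> a * 2 ^ p + 1" by linarith+
  moreover have "1 < (b - a) * 2 ^ p" using p by (simp add: field_simps power_divide)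
  ultimately have "a < real n / 2 ^ p" "real n / 2 ^ p < b" by (simp_all add: field_simps)
  then show ?thesis unfolding dyadic_def by blast
qed

text \<open>Strictness at \<sigma> leaves an open interval between
  \<open>U (\<sigma> @ [False])\<close> and \<open>2 * x - U (\<sigma> @ [True])\<close>. A dyadic
  value from it for the left child forces a suitable dyadic value for the right one.\<close>

lemma dyadic_martingale_above:
  assumes S: "martingale S" "\<And>\<sigma>. dyadic (S \<sigma>)" and U: "martingale U"
    and "\<And>\<sigma>. length \<sigma> = m \<Longrightarrow> U \<sigma> < S \<sigma>"
  shows "\<exists>S'. martingale S' \<and> (\<forall>\<sigma>. dyadic (S' \<sigma>)) \<and> (\<forall>\<sigma>. length \<sigma> \<le> m \<longrightarrow> S' \<sigma> = S \<sigma>) \<and>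
    (\<forall>\<sigma>. m \<le> length \<sigma> \<longrightarrow> U \<sigma> < S' \<sigma>)"
proof -
  define P where "P \<sigma> x \<longleftrightarrow> dyadic x \<and> (length \<sigma> \<le> m \<longrightarrow> x = S \<sigma>) \<and> (m \<le> length \<sigma> \<longrightarrow> U \<sigma> < x)" for \<sigma> x
  have "\<exists>F. \<forall>\<sigma>. P \<sigma> (F \<sigma>) \<and> 2 * F \<sigma> = F (\<sigma> @ [False]) + F (\<sigma> @ [True])"
  proof (rule tree_choice)
    show "P [] (S [])" using assms by (auto simp: P_def)
    fix \<sigma> x assume P: "P \<sigma> x"
    show "\<exists>y z. P (\<sigma> @ [False]) y \<and> P (\<sigma> @ [True]) z \<and> 2 * x = y + z"
    proof (cases "m \<le> length \<sigma>")
      case False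
      then show ?thesis using assms P
        by (intro exI[of _ "S (\<sigma> @ [False])"] exI[of _ "S (\<sigma> @ [True])"]) (auto simp: P_def martingale_def)
    next
      case True
      have U': "2 * U \<sigma> = U (\<sigma> @ [False]) + U (\<sigma> @ [True])" "0 \<le> U (\<sigma> @ [b])" for b
        using U by (auto simp: martingale_def)
      have "U \<sigma> < x" "dyadic x" using P True by (auto simp: P_def)
      then obtain y where y: "dyadic y" "U (\<sigma> @ [False]) < y" "y < 2 * x - U (\<sigma> @ [True])"
        using dyadic_dense[of "U (\<sigma> @ [False])" "2 * x - U (\<sigma> @ [True])"] U' by auto
      have "dyadic (2 * x - y)"
        using y U'(2)[of True] \<open>dyadic x\<close> by (intro dyadic_double_diff) auto
      then show ?thesis using y True by (intro exI[of _ y] exI[of _ "2 * x - y"]) (auto simp: P_def)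
    qed
  qed
  then obtain F where F: "\<And>\<sigma>. P \<sigma> (F \<sigma>)" "\<And>\<sigma>. 2 * F \<sigma> = F (\<sigma> @ [False]) + F (\<sigma> @ [True])" by blast
  have "martingale F"
    unfolding martingale_def using F dyadic_nonneg by (auto simp: P_def)
  with F show ?thesis by (intro exI[of _ F]) (auto simp: P_def)
qed

lemma finite_strings_le: "finite {\<sigma> :: bool list. length \<sigma> \<le> K}"
  using finite_lists_length_le[of "UNIV :: bool set" K] by simp

text \<open>Compactness: the pigeonhole principle fixes one more coordinate at a time on an infinite
  set of indices, and the diagonal is the cluster point.\<close>

lemma bounded_sequence_cluster:
  fixes f :: "nat \<Rightarrow> nat \<Rightarrow> nat"
  assumes "\<And>s j. j < s \<Longrightarrow> f s j \<le> b j"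
  shows "\<exists>g. \<forall>N. infinite {s. \<forall>j < N. f s j = g j}"
proof -
  define P where "P N h \<longleftrightarrow> infinite {s. \<forall>j < N. f s j = h j}" for N and h :: "nat \<Rightarrow> nat"
  have "\<exists>H. \<forall>N. P N (H N) \<and> (\<forall>j < N. H (Suc N) j = H N j)"
  proof (rule dependent_nat_choice)
    show "\<exists>h. P 0 h" by (simp add: P_def)
    fix h N assume "P N h"
    \<comment> \<open>The bound on \<open>f s N\<close> holds for \<open>N < s\<close>; dropping the
      finitely many other indices keeps the set infinite.\<close>
    let ?A = "{s. \<forall>j < N. f s j = h j} \<inter> {N<..}"
    have "?A = {s. \<forall>j < N. f s j = h j} - {..N}" by auto
    then have "infinite ?A" using \<open>P N h\<close> by (simp add: P_def)
    moreover have "(\<lambda>s. f s N) ` ?A \<subseteq> {..b N}" using assms by auto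
    then have "finite ((\<lambda>s. f s N) ` ?A)" by (rule finite_subset) simp
    ultimately obtain s0 where "infinite {s \<in> ?A. f s N = f s0 N}"
      using pigeonhole_infinite[of ?A "\<lambda>s. f s N"] by blast
    moreover have "{s \<in> ?A. f s N = f s0 N} \<subseteq> {s. \<forall>j < Suc N. f s j = (h(N := f s0 N)) j}"
      by (auto simp: less_Suc_eq)
    ultimately have "P (Suc N) (h(N := f s0 N))" unfolding P_def using finite_subset by blast
    then show "\<exists>h'. P (Suc N) h' \<and> (\<forall>j < N. h' j = h j)" by (intro exI[of _ "h(N := f s0 N)"]) auto
  qed
  then obtain H where H: "\<And>N. P N (H N)" "\<And>N j. j < N \<Longrightarrow> H (Suc N) j = H N j" by blast
  have diag: "H N j = H (Suc j) j" if "j < N" for N j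
    using that
  proof (induction N)
    case (Suc N)
    then show ?case by (cases "j = N") (auto simp: H(2))
  qed simp
  have "{s. \<forall>j < N. f s j = H N j} \<subseteq> {s. \<forall>j < N. f s j = H (Suc j) j}" for N
  proof safe
    fix s j assume "\<forall>j < N. f s j = H N j" "j < N"
    then show "f s j = H (Suc j) j" using diag[of j N] by metis
  qed
  then have "P N (\<lambda>j. H (Suc j) j)" for N
    using H(1)[of N] unfolding P_def using finite_subset by blast
  then show ?thesis unfolding P_def by (intro exI[of _ "\<lambda>j. H (Suc j) j"]) blast
qed

section \<open>The forcing question\<close>

lemma idx_pos [simp]: "0 < idx \<sigma>"
  using idx_ge[of \<sigma>] by (metis gr0I le_zero_eq power_not_zero zero_neq_numeral)

lemma length_less_iff_idx: "length \<sigma> < K \<longleftrightarrow> idx \<sigma> < 2 ^ K"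
proof (cases K)
  case 0
  then show ?thesis by (simp add: Suc_le_eq)
next
  case (Suc k)
  then show ?thesis using length_le_iff_idx[of \<sigma> k] by (simp add: less_Suc_eq_le)
qed

lemma length_str: "0 < j \<Longrightarrow> length (str j) \<le> K \<longleftrightarrow> j < 2 * 2 ^ K"
  by (simp add: length_le_iff_idx idx_str)

lemma length_str_eq: "r < 2 ^ l \<Longrightarrow> length (str (2 ^ l + r)) = l"
  using length_le_iff_idx[of "str (2 ^ l + r)" l] length_less_iff_idx[of "str (2 ^ l + r)" l]
  by (simp add: idx_str)

lemma idx_level: "length \<sigma> = l \<Longrightarrow> \<exists>r < 2 ^ l. idx \<sigma> = 2 ^ l + r"
  using idx_ge[of \<sigma>] idx_less[of \<sigma>] by (intro exI[of _ "idx \<sigma> - 2 ^ l"]) auto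

lemma idx_take_div: "m \<le> length \<sigma> \<Longrightarrow> idx \<sigma> div 2 ^ (length \<sigma> - m) = idx (take m \<sigma>)"
  using idx_append_div[of "take m \<sigma>" "drop m \<sigma>"] by simp

text \<open>The exponent is split as \<open>p + P\<close> because \<open>dominates\<close> refines a
  given table with denominator \<open>2 ^ p\<close>.\<close>

lemma dyadic_table:
  assumes "\<And>\<sigma>. dyadic (S \<sigma>)"
  shows "\<exists>P b t. \<forall>\<sigma>. length \<sigma> \<le> K \<longrightarrow> S \<sigma> = real (digit b t (idx \<sigma>)) / 2 ^ (p + P)"
proof -
  obtain q where q: "\<forall>r \<ge> q. \<forall>\<sigma> \<in> {\<sigma>. length \<sigma> \<le> K}. \<exists>n :: nat. S \<sigma> = real n / 2 ^ r"
    using dyadic_scale_finite[OF finite_strings_le, of K S] assms by blast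
  then have "\<forall>\<sigma>. \<exists>n :: nat. length \<sigma> \<le> K \<longrightarrow> S \<sigma> = real n / 2 ^ (p + q)"
    by (metis le_add2 mem_Collect_eq)
  then obtain g :: "bool list \<Rightarrow> nat" where g: "\<And>\<sigma>. length \<sigma> \<le> K \<Longrightarrow> S \<sigma> = real (g \<sigma>) / 2 ^ (p + q)"
    by metis
  \<comment> \<open>One more than the sum of all entries, hence above each of them.\<close>
  let ?b = "Suc (\<Sum>j < 2 * 2 ^ K. g (str j))"
  have "g (str j) < ?b" if "j < 2 * 2 ^ K" for j
    using that member_le_sum[of j "{..<2 * 2 ^ K}" "\<lambda>j. g (str j)"] by simp
  then obtain t where "\<forall>j < 2 * 2 ^ K. digit ?b t j = g (str j)"
    using digit_table[of "2 * 2 ^ K" "\<lambda>j. g (str j)" ?b] by blast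
  then have "\<forall>\<sigma>. length \<sigma> \<le> K \<longrightarrow> S \<sigma> = real (digit ?b t (idx \<sigma>)) / 2 ^ (p + q)"
    using g by (simp add: length_le_iff_idx)
  then show ?thesis by blast
qed

lemma valid_table_cong:
  assumes "valid_table m d B v s'" "s \<le> s'" "\<And>j. j < s \<Longrightarrow> v j = w j"
  shows "valid_table m d B w s"
  unfolding valid_table_def
proof (intro conjI allI impI)
  fix j assume "j < s"
  then have "v j \<le> B * (j * j)" using assms(1,2) unfolding valid_table_def by auto
  then show "w j \<le> B * (j * j)" using assms(3) \<open>j < s\<close> by simp
next
  fix j assume "j < s" "2 ^ m \<le> j \<and> 2 * j + 1 < s"
  then have "v (2 * j) + v (2 * j + 1) \<le> 8 * v j" using assms(1,2) by (auto simp: valid_table_def)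
  then show "w (2 * j) + w (2 * j + 1) \<le> 8 * w j"
    using assms(3)[of j] assms(3)[of "2 * j"] assms(3)[of "2 * j + 1"] \<open>2 ^ m \<le> j \<and> 2 * j + 1 < s\<close> by simp
next
  fix j assume "j < s" "2 ^ m \<le> j \<and> j < 2 * 2 ^ m"
  then have "v j \<le> d j" using assms(1,2) unfolding valid_table_def by auto
  then show "w j \<le> d j" using assms(3) \<open>j < s\<close> by simp
qed

lemma dominates_cong:
  assumes "dominates m p a c P K A v" "\<And>j. j < 2 * 2 ^ K \<Longrightarrow> v j = w j"
  shows "dominates m p a c P K A w"
proof -
  have "v (2 ^ l + r) = w (2 ^ l + r)" if "l < Suc K" "r < 2 ^ l" for l r
  proof (rule assms(2))
    have "(2::nat) ^ l \<le> 2 ^ K" using that by (simp add: power_increasing)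
    then show "2 ^ l + r < 2 * 2 ^ K" using that by linarith
  qed
  then show ?thesis using assms(1) by (simp add: dominates_def)
qed

text \<open>Such a \<open>v\<close> is a counterexample to the forcing question for the bit
  \<open>i\<close>, with no bound on the search.\<close>

definition avoids ::
    "recf \<Rightarrow> nat \<Rightarrow> nat \<Rightarrow> (nat \<Rightarrow> nat) \<Rightarrow> (nat \<Rightarrow> nat) \<Rightarrow> nat \<Rightarrow> nat \<Rightarrow> (nat \<Rightarrow> nat) \<Rightarrow> bool" where
  "avoids e m p a c i n v \<longleftrightarrow> (\<forall>P K b t u. dominates m p a c P K (digit b t) v \<longrightarrow>
    sim e (table_oracle (p + P) K b t) u [n] \<noteq> Suc i)"

text \<open>Each \<open>s\<close> yields a finite counterexample, and a cluster point of these
  works: validity and domination look at finitely many entries at a time.\<close>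

lemma uncovered_imp_avoids:
  assumes "\<And>s. \<not> covered e m p d a c B i s n"
  shows "\<exists>v. (\<forall>s. valid_table m d B v s) \<and> avoids e m p a c i n v"
proof -
  define f where "f s w = digit (B * (s * s) + 1) w" for s w
  have "\<exists>w. valid_table m d B (f s w) s \<and>
      (\<forall>P < s. \<forall>K < s. \<forall>b < s. \<forall>t < s. \<forall>u < s. 2 * 2 ^ K \<le> s \<longrightarrow> dominates m p a c P K (digit b t) (f s w) \<longrightarrow>
        sim e (table_oracle (p + P) K b t) u [n] \<noteq> Suc i)" for s
    using assms[of s] unfolding covered_def f_def by blast
  then obtain W where valid: "\<And>s. valid_table m d B (f s (W s)) s" and
    none: "\<And>s P K b t u. P < s \<Longrightarrow> K < s \<Longrightarrow> b < s \<Longrightarrow> t < s \<Longrightarrow> u < s \<Longrightarrow> 2 * 2 ^ K \<le> s \<Longrightarrow>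
       dominates m p a c P K (digit b t) (f s (W s)) \<Longrightarrow> sim e (table_oracle (p + P) K b t) u [n] \<noteq> Suc i"
    by metis
  define h where "h s = f s (W s)" for s
  have "h s j \<le> B * (j * j)" if "j < s" for s j
    using valid[of s] that by (auto simp: valid_table_def h_def)
  then obtain g where g: "\<And>N. infinite {s. \<forall>j < N. h s j = g j}"
    using bounded_sequence_cluster[of h "\<lambda>j. B * (j * j)"] by blast
  have near: "\<exists>s \<ge> M. \<forall>j < N. h s j = g j" for M N
    using g[of N] unfolding finite_nat_set_iff_bounded by (auto simp: not_less)
  have "valid_table m d B g s" for s
  proof -
    obtain s' where "s' \<ge> s" "\<forall>j < s. h s' j = g j" using near by blast
    then show ?thesis using valid[of s'] valid_table_cong[of m d B "h s'" s' s g] by (simp add: h_def)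
  qed
  moreover have "avoids e m p a c i n g"
    unfolding avoids_def
  proof (intro allI impI)
    fix P K b t u assume dom: "dominates m p a c P K (digit b t) g"
    \<comment> \<open>This \<open>s\<close> exceeds all search bounds in \<open>covered\<close>, and
      its table agrees with \<open>g\<close> on every node up to level \<open>K\<close>.\<close>
    obtain s where s: "s \<ge> Suc (P + K + b + t + u) + 2 * 2 ^ K" "\<forall>j < 2 * 2 ^ K. h s j = g j"
      using near by blast
    have "dominates m p a c P K (digit b t) (h s)"
      by (rule dominates_cong[OF dom]) (use s(2) in auto)
    then show "sim e (table_oracle (p + P) K b t) u [n] \<noteq> Suc i"
      using none[of P s K b t u] s(1) by (simp add: h_def)
  qed
  ultimately show ?thesis by blast
qed

text \<open>The first \<open>s\<close> entries of \<open>v\<close> form one of the tables over which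
  \<open>covered\<close> quantifies.\<close>

lemma covered_imp_dominates:
  assumes "covered e m p d a c B i s n" "\<And>s. valid_table m d B v s"
  shows "\<exists>P K b t u. dominates m p a c P K (digit b t) v \<and> sim e (table_oracle (p + P) K b t) u [n] = Suc i"
proof -
  have "v j < B * (s * s) + 1" if "j < s" for j
  proof -
    have "v j \<le> B * (j * j)" using assms(2)[of s] that by (auto simp: valid_table_def)
    also have "\<dots> \<le> B * (s * s)" using that by (intro mult_le_mono) auto
    finally show ?thesis by simp
  qed
  then obtain w where w: "w < (B * (s * s) + 1) ^ s" "\<forall>j < s. digit (B * (s * s) + 1) w j = v j"
    using digit_table by blast
  have "valid_table m d B (digit (B * (s * s) + 1) w) s"
    by (rule valid_table_cong[OF assms(2)]) (use w in auto)
  then obtain P K b t u where *: "2 * 2 ^ K \<le> s" "dominates m p a c P K (digit b t) (digit (B * (s * s) + 1) w)"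
    "sim e (table_oracle (p + P) K b t) u [n] = Suc i"
    using assms(1) w(1) unfolding covered_def by blast
  have "dominates m p a c P K (digit b t) v"
    by (rule dominates_cong[OF *(2)]) (use w *(1) in auto)
  with * show ?thesis by blast
qed

section \<open>Translation between integer tables and real-valued martingales\<close>

lemma scaled_le_iff:
  "real c / 2 ^ p + real v / 4 ^ l \<le> real A / 2 ^ (p + P) \<longleftrightarrow> 2 ^ P * (c * 4 ^ l + v * 2 ^ p) \<le> A * 4 ^ l"
proof -
  have "real c / 2 ^ p + real v / 4 ^ l = real (2 ^ P * (c * 4 ^ l + v * 2 ^ p)) / (2 ^ (p + P) * 4 ^ l)"
    by (simp add: field_simps power_add)
  moreover have "real A / 2 ^ (p + P) = real (A * 4 ^ l) / (2 ^ (p + P) * 4 ^ l)"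
    by simp
  moreover have "(0::real) < 2 ^ (p + P) * 4 ^ l" by simp
  ultimately have "real c / 2 ^ p + real v / 4 ^ l \<le> real A / 2 ^ (p + P) \<longleftrightarrow>
      real (2 ^ P * (c * 4 ^ l + v * 2 ^ p)) \<le> real (A * 4 ^ l)"
    by (simp only: divide_le_cancel) (meson order.asym)
  then show ?thesis by (simp only: of_nat_le_iff)
qed

lemma dominatesI:
  assumes "martingale S" "m \<le> K"
    and A: "\<And>\<sigma>. length \<sigma> \<le> K \<Longrightarrow> S \<sigma> = real (A (idx \<sigma>)) / 2 ^ (p + P)"
    and a: "\<And>\<sigma>. length \<sigma> \<le> m \<Longrightarrow> S \<sigma> = real (a (idx \<sigma>)) / 2 ^ p"
    and v: "\<And>\<sigma>. m \<le> length \<sigma> \<Longrightarrow> real (c (idx (take m \<sigma>))) / 2 ^ p + real (v (idx \<sigma>)) / 4 ^ length \<sigma> \<le> S \<sigma>"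
  shows "dominates m p a c P K A v"
  unfolding dominates_def
proof (intro conjI allI impI)
  show "m \<le> K" by fact
next
  fix j :: nat assume j: "j < 2 * 2 ^ m" "0 < j"
  then have "length (str j) \<le> m" by (simp add: length_str)
  then have "real (A j) / 2 ^ (p + P) = real (a j) / 2 ^ p"
    using A[of "str j"] a[of "str j"] j \<open>m \<le> K\<close> by (simp add: idx_str)
  then have "real (A j) = real (a j * 2 ^ P)" by (simp add: field_simps power_add)
  then show "A j = a j * 2 ^ P" by (simp only: of_nat_eq_iff)
next
  fix j :: nat assume j: "j < 2 ^ K" "0 < j"
  define \<sigma> where "\<sigma> = str j"
  have \<sigma>: "idx \<sigma> = j" using j by (simp add: \<sigma>_def idx_str)
  then have "length \<sigma> < K" using j by (simp add: length_less_iff_idx)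
  then have "S \<sigma> = real (A j) / 2 ^ (p + P)" "S (\<sigma> @ [False]) = real (A (2 * j)) / 2 ^ (p + P)"
    "S (\<sigma> @ [True]) = real (A (2 * j + 1)) / 2 ^ (p + P)"
    using A[of \<sigma>] A[of "\<sigma> @ [False]"] A[of "\<sigma> @ [True]"] \<sigma> by simp_all
  moreover have "2 * S \<sigma> = S (\<sigma> @ [False]) + S (\<sigma> @ [True])"
    using assms(1) by (simp add: martingale_def)
  ultimately have "2 * real (A j) / 2 ^ (p + P) = (real (A (2 * j)) + real (A (2 * j + 1))) / 2 ^ (p + P)"
    by (simp add: add_divide_distrib)
  then have "2 * real (A j) = real (A (2 * j)) + real (A (2 * j + 1))"
    by (simp only: divide_cancel_right) simp
  then show "2 * A j = A (2 * j) + A (2 * j + 1)" by linarith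
next
  fix l r :: nat assume lr: "l < Suc K" "m \<le> l" "r < 2 ^ l"
  define \<sigma> where "\<sigma> = str (2 ^ l + r)"
  define j where "j = 2 ^ l + r"
  have \<sigma>: "idx \<sigma> = j" "length \<sigma> = l" using lr by (simp_all add: \<sigma>_def j_def idx_str length_str_eq)
  have c: "j div 2 ^ (l - m) = idx (take m \<sigma>)" using idx_take_div[of m \<sigma>] \<sigma> lr by simp
  have "real (c (j div 2 ^ (l - m))) / 2 ^ p + real (v j) / 4 ^ l \<le> real (A j) / 2 ^ (p + P)"
    unfolding c using v[of \<sigma>] A[of \<sigma>] \<sigma> lr by simp
  then show "2 ^ P * (c ((2 ^ l + r) div 2 ^ (l - m)) * 4 ^ l + v (2 ^ l + r) * 2 ^ p) \<le> A (2 ^ l + r) * 4 ^ l"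
    unfolding j_def scaled_le_iff .
qed

lemma dominatesE:
  assumes "dominates m p a c P K A v"
  obtains S where "martingale S" "\<And>\<sigma>. dyadic (S \<sigma>)" "m \<le> K"
    "\<And>\<sigma>. length \<sigma> \<le> K \<Longrightarrow> S \<sigma> = real (A (idx \<sigma>)) / 2 ^ (p + P)"
    "\<And>\<sigma>. length \<sigma> \<le> m \<Longrightarrow> S \<sigma> = real (a (idx \<sigma>)) / 2 ^ p"
    "\<And>\<sigma>. m \<le> length \<sigma> \<Longrightarrow> length \<sigma> \<le> K \<Longrightarrow>
      real (c (idx (take m \<sigma>))) / 2 ^ p + real (v (idx \<sigma>)) / 4 ^ length \<sigma> \<le> S \<sigma>"
proof -
  \<comment> \<open>Beyond level \<open>K\<close> the martingale is constant along every
    branch.\<close>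
  define S where "S \<sigma> = real (A (idx (take K \<sigma>))) / 2 ^ (p + P)" for \<sigma>
  have "m \<le> K" using assms by (simp add: dominates_def)
  have "2 * S \<sigma> = S (\<sigma> @ [False]) + S (\<sigma> @ [True])" for \<sigma>
  proof (cases "length \<sigma> < K")
    case True
    then have "2 * A (idx \<sigma>) = A (2 * idx \<sigma>) + A (2 * idx \<sigma> + 1)"
      using assms by (simp add: dominates_def length_less_iff_idx)
    then have "2 * real (A (idx \<sigma>)) = real (A (2 * idx \<sigma>)) + real (A (2 * idx \<sigma> + 1))"
      by linarith
    with True show ?thesis by (simp add: S_def divide_simps)
  next
    case False
    then show ?thesis by (simp add: S_def)
  qed
  then have "martingale S" by (simp add: martingale_def S_def)
  moreover have "dyadic (S \<sigma>)" for \<sigma> unfolding S_def dyadic_def by blast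
  moreover have "S \<sigma> = real (a (idx \<sigma>)) / 2 ^ p" if "length \<sigma> \<le> m" for \<sigma>
  proof -
    have "A (idx \<sigma>) = a (idx \<sigma>) * 2 ^ P"
      using assms that by (simp add: dominates_def length_le_iff_idx)
    then show ?thesis using that \<open>m \<le> K\<close> by (simp add: S_def power_add)
  qed
  moreover have "real (c (idx (take m \<sigma>))) / 2 ^ p + real (v (idx \<sigma>)) / 4 ^ length \<sigma> \<le> S \<sigma>"
    if "m \<le> length \<sigma>" "length \<sigma> \<le> K" for \<sigma>
  proof -
    obtain r where r: "r < 2 ^ length \<sigma>" "idx \<sigma> = 2 ^ length \<sigma> + r" using idx_level by blast
    have "2 ^ P * (c (idx (take m \<sigma>)) * 4 ^ length \<sigma> + v (idx \<sigma>) * 2 ^ p) \<le> A (idx \<sigma>) * 4 ^ length \<sigma>"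
      using assms that r by (simp add: dominates_def flip: idx_take_div)
    then show ?thesis using that by (simp add: S_def scaled_le_iff)
  qed
  moreover have "S \<sigma> = real (A (idx \<sigma>)) / 2 ^ (p + P)" if "length \<sigma> \<le> K" for \<sigma>
    using that by (simp add: S_def)
  ultimately show ?thesis using that \<open>m \<le> K\<close> by blast
qed

text \<open>A computation uses a finite part of \<open>R\<close>, and that part is among the finite
  extensions that \<open>avoids\<close> excludes.\<close>

lemma avoids_imp_not_eval:
  assumes R: "martingale R" "\<And>\<sigma>. dyadic (R \<sigma>)"
    and a: "\<And>\<sigma>. length \<sigma> \<le> m \<Longrightarrow> R \<sigma> = real (a (idx \<sigma>)) / 2 ^ p"
    and v: "\<And>\<sigma>. m \<le> length \<sigma> \<Longrightarrow> real (c (idx (take m \<sigma>))) / 2 ^ p + real (v (idx \<sigma>)) / 4 ^ length \<sigma> \<le> R \<sigma>"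
    and avoids: "avoids e m p a c i n v"
  shows "\<not> eval (mart_oracle R) e [n] i"
proof
  assume ev: "eval (mart_oracle R) e [n] i"
  \<comment> \<open>Every level has its own denominator and table; the level also serves as the
    search bound of the simulation.\<close>
  have "\<forall>K. \<exists>P b t. \<forall>\<sigma>. length \<sigma> \<le> K \<longrightarrow> R \<sigma> = real (digit b t (idx \<sigma>)) / 2 ^ (p + P)"
    using dyadic_table[of R] R(2) by blast
  then obtain P b t where Pbt: "\<And>K \<sigma>. length \<sigma> \<le> K \<Longrightarrow> R \<sigma> = real (digit (b K) (t K) (idx \<sigma>)) / 2 ^ (p + P K)"
    by metis
  define L where "L K = table_oracle (p + P K) K (b K) (t K)" for K
  have L: "L K x = (if length (list_decode (fst (prod_decode x))) \<le> K then Suc (mart_oracle R x) else 0)" for K x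
    unfolding L_def by (rule table_oracle_eq) (rule Pbt)
  have "eventually (\<lambda>K. L K x = Suc (mart_oracle R x)) sequentially" for x
    using eventually_ge_at_top[of "length (list_decode (fst (prod_decode x)))"]
    by eventually_elim (simp add: L)
  then have "eventually (\<lambda>K. sim e (L K) K [n] = Suc i) sequentially"
    using sim_complete ev by blast
  then have "eventually (\<lambda>K. sim e (L K) K [n] = Suc i \<and> m \<le> K) sequentially"
    using eventually_ge_at_top by (rule eventually_conj)
  then obtain K where K: "sim e (L K) K [n] = Suc i" "m \<le> K"
    by (auto dest: eventually_happens)
  have "dominates m p a c (P K) K (digit (b K) (t K)) v"
    by (rule dominatesI[OF R(1) K(2) Pbt a v])
  then show False using avoids K(1) by (auto simp: avoids_def L_def)
qed

text \<open>Search for the first \<open>s\<close> with a positive answer; bit 1 has priority if both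
  bits have one there.\<close>

lemma computable_selection:
  assumes "\<And>i. decidable 2 (\<lambda>v. C i (v 0) (v 1))" and "\<And>n. \<exists>s. C (0::nat) s n \<or> C 1 s n"
  shows "computable (\<lambda>n. C 1 (LEAST s. C 0 s n \<or> C 1 s n) n)"
proof -
  have d: "decidable 2 (\<lambda>v. C 0 (v 0) (v 1) \<or> C 1 (v 0) (v 1))"
    by (intro decidable_disj assms)
  have L: "comp_fun 1 (\<lambda>v. LEAST s. C 0 s (v 0) \<or> C 1 s (v 0))"
    by (rule comp_fun_Least) (use d assms(2) in \<open>simp_all add: numeral_2_eq_2\<close>)
  have "comp_fun 2 (\<lambda>v. (if C 1 (v 0) (v 1) then 1 else 0))" using assms(1) by (simp add: decidable_def)
  then have "comp_fun 1 (\<lambda>v. if C 1 (LEAST s. C 0 s (v 0) \<or> C 1 s (v 0)) (v 0) then 1 else 0)"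
    by (rule comp_fun_comp2[where f = "\<lambda>s n. if C 1 s n then 1 else 0", OF _ L comp_fun_var]) simp
  then obtain e where e: "\<forall>xs. length xs = 1 \<longrightarrow> eval (\<lambda>_. 0) e xs
      (if C 1 (LEAST s. C 0 s (xs ! 0) \<or> C 1 s (xs ! 0)) (xs ! 0) then 1 else 0)"
    unfolding comp_fun_def by blast
  show ?thesis
    unfolding computable_def computable_in_def
    by (intro exI[of _ e] allI) (use e[rule_format, of "[_]"] in simp)
qed

section \<open>Rounding a bounded martingale into the compact class\<close>

lemma finite_strings_eq: "finite {\<sigma> :: bool list. length \<sigma> = m}"
  by (rule finite_subset[OF _ finite_strings_le[of m]]) auto

lemma uniform_gap:
  fixes S U :: "bool list \<Rightarrow> real"
  assumes "\<And>\<sigma>. length \<sigma> = m \<Longrightarrow> U \<sigma> < S \<sigma>"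
  shows "\<exists>\<delta> > 0. \<forall>\<sigma>. length \<sigma> = m \<longrightarrow> U \<sigma> + \<delta> \<le> S \<sigma>"
proof -
  let ?A = "(\<lambda>\<sigma>. S \<sigma> - U \<sigma>) ` {\<sigma> :: bool list. length \<sigma> = m}"
  have A: "finite ?A" "?A \<noteq> {}"
    using finite_strings_eq[of m] Ex_list_of_length[of m] by auto
  then have "Min ?A > 0" using assms by (subst Min_gr_iff) auto
  moreover have "U \<sigma> + Min ?A \<le> S \<sigma>" if "length \<sigma> = m" for \<sigma>
  proof -
    have "Min ?A \<le> S \<sigma> - U \<sigma>" by (rule Min_le[OF A(1)]) (use that in auto)
    then show ?thesis by simp
  qed
  ultimately show ?thesis by blast
qed

text \<open>Adding \<open>2 ^ l\<close> before rounding up leaves room for the rounding errors of the two children.\<close>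

definition grid :: "(bool list \<Rightarrow> real) \<Rightarrow> nat \<Rightarrow> nat" where
  "grid D j = (if j = 0 then 0 else nat \<lceil>4 ^ length (str j) * D (str j) + 2 ^ length (str j)\<rceil>)"

lemma grid_bounds:
  assumes "martingale D"
  shows "4 ^ length \<sigma> * D \<sigma> + 2 ^ length \<sigma> \<le> real (grid D (idx \<sigma>))"
    "real (grid D (idx \<sigma>)) \<le> 4 ^ length \<sigma> * D \<sigma> + 2 ^ length \<sigma> + 1"
proof -
  have "0 \<le> 4 ^ length \<sigma> * D \<sigma> + 2 ^ length \<sigma>" using martingale_nonneg[OF assms, of \<sigma>] by simp
  then have "real (grid D (idx \<sigma>)) = of_int \<lceil>4 ^ length \<sigma> * D \<sigma> + 2 ^ length \<sigma>\<rceil>"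
    using idx_pos[of \<sigma>] by (simp add: grid_def del: idx_pos)
  then show "4 ^ length \<sigma> * D \<sigma> + 2 ^ length \<sigma> \<le> real (grid D (idx \<sigma>))"
    "real (grid D (idx \<sigma>)) \<le> 4 ^ length \<sigma> * D \<sigma> + 2 ^ length \<sigma> + 1" by linarith+
qed

lemma four_power: "(4::'a::comm_semiring_1) ^ l = 2 ^ l * 2 ^ l"
  by (simp flip: power_mult_distrib)

text \<open>Places the rounding of \<open>D\<close> in the class over which \<open>covered\<close>
  quantifies, so a positive answer provides an extension above \<open>D\<close>.\<close>

lemma valid_table_grid:
  assumes D: "martingale D" "bounded_fun D"
  shows "\<exists>B. \<forall>m s. valid_table m (\<lambda>j. if j < 2 * 2 ^ m then grid D j else 0) B (grid D) s"
proof -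
  obtain B where B: "\<And>\<sigma>. \<bar>D \<sigma>\<bar> \<le> B" using D(2) by (auto simp: bounded_fun_def)
  \<comment> \<open>At level \<open>l\<close> rounding adds at most \<open>2 ^ l + 1\<close>, which
    is at most \<open>2 * 4 ^ l\<close>; this accounts for the 2.\<close>
  define b where "b = nat \<lceil>B\<rceil> + 2"
  have "0 \<le> B" using B[of "[]"] by linarith
  then have b: "B + 2 \<le> real b" by (simp add: b_def)
  have bound: "grid D j \<le> b * (j * j)" for j
  proof (cases "j = 0")
    case True
    then show ?thesis by (simp add: grid_def)
  next
    case False
    define \<sigma> where "\<sigma> = str j"
    have \<sigma>: "idx \<sigma> = j" using False by (simp add: \<sigma>_def idx_str)
    have 1: "(1::real) \<le> 2 ^ length \<sigma>" "(2::real) ^ length \<sigma> \<le> 4 ^ length \<sigma>" by (simp_all add: power_mono)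
    have "real (grid D j) \<le> 4 ^ length \<sigma> * D \<sigma> + 2 ^ length \<sigma> + 1"
      using grid_bounds(2)[OF D(1), of \<sigma>] \<sigma> by simp
    also have "\<dots> \<le> 4 ^ length \<sigma> * B + 2 * 4 ^ length \<sigma>"
    proof -
      have "4 ^ length \<sigma> * D \<sigma> \<le> 4 ^ length \<sigma> * B" using B[of \<sigma>] by (intro mult_left_mono) auto
      then show ?thesis using 1 by linarith
    qed
    also have "\<dots> = (B + 2) * 4 ^ length \<sigma>" by (simp add: algebra_simps)
    also have "\<dots> \<le> real b * real (j * j)"
    proof (rule mult_mono)
      have "(2 ^ length \<sigma>) * (2 ^ length \<sigma>) \<le> j * j" using idx_ge[of \<sigma>] \<sigma> by (intro mult_le_mono) auto
      then have "real (2 ^ length \<sigma> * 2 ^ length \<sigma>) \<le> real (j * j)" by (simp only: of_nat_le_iff)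
      then show "(4::real) ^ length \<sigma> \<le> real (j * j)" by (simp add: four_power)
    qed (use b in auto)
    finally have "real (grid D j) \<le> real (b * (j * j))" by simp
    then show ?thesis by (simp only: of_nat_le_iff)
  qed
  have super: "grid D (2 * j) + grid D (2 * j + 1) \<le> 8 * grid D j" if "0 < j" for j
  proof -
    define \<sigma> where "\<sigma> = str j"
    have \<sigma>: "idx \<sigma> = j" using that by (simp add: \<sigma>_def idx_str)
    have "real (grid D (2 * j)) \<le> 4 * 4 ^ length \<sigma> * D (\<sigma> @ [False]) + 2 * 2 ^ length \<sigma> + 1"
      "real (grid D (2 * j + 1)) \<le> 4 * 4 ^ length \<sigma> * D (\<sigma> @ [True]) + 2 * 2 ^ length \<sigma> + 1"
      using grid_bounds(2)[OF D(1), of "\<sigma> @ [False]"] grid_bounds(2)[OF D(1), of "\<sigma> @ [True]"] \<sigma> by simp_all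
    moreover have "4 ^ length \<sigma> * D \<sigma> + 2 ^ length \<sigma> \<le> real (grid D j)"
      using grid_bounds(1)[OF D(1), of \<sigma>] \<sigma> by simp
    moreover have "4 * 4 ^ length \<sigma> * D (\<sigma> @ [False]) + 4 * 4 ^ length \<sigma> * D (\<sigma> @ [True]) = 8 * (4 ^ length \<sigma> * D \<sigma>)"
      unfolding martingale_step[OF D(1), of \<sigma>] by (simp add: algebra_simps)
    moreover have "(1::real) \<le> 2 ^ length \<sigma>" by simp
    ultimately have "real (grid D (2 * j)) + real (grid D (2 * j + 1)) \<le> 8 * real (grid D j)" by linarith
    then show ?thesis by linarith
  qed
  have "valid_table m (\<lambda>j. if j < 2 * 2 ^ m then grid D j else 0) b (grid D) s" for m s
  proof -
    have "0 < j" if "2 ^ m \<le> j" for j :: nat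
      using that by (metis gr0I le_zero_eq power_not_zero zero_neq_numeral)
    then show ?thesis using bound super by (auto simp: valid_table_def)
  qed
  then show ?thesis by blast
qed

text \<open>Turns a counterexample from the compact class into a bounded martingale, which a
  condition can require \<open>S\<close> to dominate.\<close>

lemma valid_table_majorant:
  assumes "\<And>s. valid_table m d B v s"
  shows "\<exists>M. martingale M \<and> bounded_fun M \<and>
    (\<forall>\<sigma>. m \<le> length \<sigma> \<longrightarrow> real (v (idx \<sigma>)) / 4 ^ length \<sigma> \<le> M \<sigma>) \<and>
    (\<forall>\<sigma>. length \<sigma> = m \<longrightarrow> M \<sigma> \<le> real (d (idx \<sigma>)) / 4 ^ m)"
proof -
  let ?V = "\<lambda>\<sigma>. real (v (idx \<sigma>)) / 4 ^ length \<sigma>"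
  have super: "?V (\<sigma> @ [False]) + ?V (\<sigma> @ [True]) \<le> 2 * ?V \<sigma>" if "m \<le> length \<sigma>" for \<sigma>
  proof -
    have "(2::nat) ^ m \<le> idx \<sigma>" using that idx_ge[of \<sigma>] power_increasing[of m "length \<sigma>" "2::nat"] by linarith
    then have "v (2 * idx \<sigma>) + v (2 * idx \<sigma> + 1) \<le> 8 * v (idx \<sigma>)"
      using assms[of "2 * idx \<sigma> + 2"] by (simp add: valid_table_def)
    then have "real (v (2 * idx \<sigma>)) + real (v (2 * idx \<sigma> + 1)) \<le> 8 * real (v (idx \<sigma>))" by linarith
    then have "(real (v (2 * idx \<sigma>)) + real (v (2 * idx \<sigma> + 1))) / (4 * 4 ^ length \<sigma>)
        \<le> 8 * real (v (idx \<sigma>)) / (4 * 4 ^ length \<sigma>)"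
      by (rule divide_right_mono) simp
    then show ?thesis by (simp add: add_divide_distrib)
  qed
  \<comment> \<open>A heap number of level \<open>l\<close> is below \<open>2 * 2 ^ l\<close>, so
    its square is below \<open>4 * 4 ^ l\<close>.\<close>
  have "?V \<sigma> \<le> 4 * real B" for \<sigma>
  proof -
    have "v (idx \<sigma>) \<le> B * (idx \<sigma> * idx \<sigma>)"
      using assms[of "Suc (idx \<sigma>)"] by (simp add: valid_table_def)
    also have "\<dots> \<le> B * ((2 * 2 ^ length \<sigma>) * (2 * 2 ^ length \<sigma>))"
      using idx_less[of \<sigma>] by (intro mult_le_mono) auto
    also have "\<dots> = 4 * B * 4 ^ length \<sigma>" by (simp add: four_power)
    finally have "real (v (idx \<sigma>)) \<le> real (4 * B * 4 ^ length \<sigma>)" by (simp only: of_nat_le_iff)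
    then show ?thesis by (simp add: field_simps)
  qed
  then obtain M where M: "martingale M" "bounded_fun M" "\<forall>\<sigma>. m \<le> length \<sigma> \<longrightarrow> ?V \<sigma> \<le> M \<sigma>"
    "\<forall>\<sigma>. length \<sigma> = m \<longrightarrow> M \<sigma> = ?V \<sigma>"
    using bounded_supermartingale_majorant[of m ?V "4 * real B"] super by auto
  moreover have "v (idx \<sigma>) \<le> d (idx \<sigma>)" if "length \<sigma> = m" for \<sigma>
    using assms[of "Suc (idx \<sigma>)"] idx_ge[of \<sigma>] idx_less[of \<sigma>] that by (simp add: valid_table_def)
  ultimately show ?thesis by (intro exI[of _ M]) (auto simp: divide_right_mono)
qed

section \<open>Forcing\<close>

text \<open>Beyond level \<open>m\<close> the values of \<open>S\<close> are provisional. Strictness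
  leaves room for later additions to \<open>U\<close>.\<close>

definition is_cond :: "(bool list \<Rightarrow> real) \<Rightarrow> nat \<Rightarrow> (bool list \<Rightarrow> real) \<Rightarrow> bool" where
  "is_cond S m U \<longleftrightarrow> martingale S \<and> (\<forall>\<sigma>. dyadic (S \<sigma>)) \<and> martingale U \<and> bounded_fun U \<and>
    (\<forall>\<sigma>. length \<sigma> = m \<longrightarrow> U \<sigma> < S \<sigma>)"

text \<open>The majorants are compared from level \<open>m'\<close> on;
  \<open>martingale_le_below\<close> recovers the shorter strings for the final martingale.\<close>

definition refines ::
    "(bool list \<Rightarrow> real) \<Rightarrow> nat \<Rightarrow> (bool list \<Rightarrow> real) \<Rightarrow> (bool list \<Rightarrow> real) \<Rightarrow> nat \<Rightarrow> (bool list \<Rightarrow> real) \<Rightarrow> bool" where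
  "refines S' m' U' S m U \<longleftrightarrow> m \<le> m' \<and> (\<forall>\<sigma>. length \<sigma> \<le> m \<longrightarrow> S' \<sigma> = S \<sigma>) \<and>
    (\<forall>\<sigma>. m' \<le> length \<sigma> \<longrightarrow> U \<sigma> \<le> U' \<sigma>)"

lemma refines_trans:
  assumes "refines S2 m2 U2 S1 m1 U1" "refines S1 m1 U1 S m U"
  shows "refines S2 m2 U2 S m U"
  unfolding refines_def
proof (intro conjI allI impI)
  show "m \<le> m2" using assms by (simp add: refines_def)
  show "S2 \<sigma> = S \<sigma>" if "length \<sigma> \<le> m" for \<sigma> using assms that by (simp add: refines_def)
  fix \<sigma> :: "bool list" assume "m2 \<le> length \<sigma>"
  then have "U \<sigma> \<le> U1 \<sigma>" "U1 \<sigma> \<le> U2 \<sigma>" using assms by (simp_all add: refines_def)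
  then show "U \<sigma> \<le> U2 \<sigma>" by simp
qed

text \<open>Makes room for four copies of the rounded \<open>D\<close>. A rounded value at level
  \<open>m1\<close> is at most \<open>D \<rho> + 2 / 2 ^ m1\<close>, whence the summand
  \<open>8 / 2 ^ m1\<close>.\<close>

lemma split_condition:
  assumes "is_cond S m U"
  obtains S1 m1 D where "martingale S1" "\<And>\<sigma>. dyadic (S1 \<sigma>)" "m \<le> m1" "\<And>\<sigma>. length \<sigma> \<le> m \<Longrightarrow> S1 \<sigma> = S \<sigma>"
    "martingale D" "bounded_fun D" "\<And>\<sigma>. m1 \<le> length \<sigma> \<Longrightarrow> U \<sigma> \<le> U (take m1 \<sigma>) + D \<sigma>"
    "\<And>\<rho>. length \<rho> = m1 \<Longrightarrow> U \<rho> + 4 * D \<rho> + 8 / 2 ^ m1 < S1 \<rho>"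
proof -
  have S: "martingale S" "\<And>\<sigma>. dyadic (S \<sigma>)" and U: "martingale U" "bounded_fun U"
    and less: "\<And>\<sigma>. length \<sigma> = m \<Longrightarrow> U \<sigma> < S \<sigma>"
    using assms by (auto simp: is_cond_def)
  obtain \<delta> where \<delta>: "\<delta> > 0" "\<And>\<sigma>. length \<sigma> = m \<Longrightarrow> U \<sigma> + \<delta> \<le> S \<sigma>"
    using uniform_gap[of m U S] less by blast
  \<comment> \<open>At level \<open>m\<close> this gives
    \<open>D \<sigma> \<le> \<delta> / 16\<close>, so \<open>4 * D \<sigma>\<close> uses a quarter
    of the gap; the choice of \<open>k\<close> keeps \<open>8 / 2 ^ m1\<close> below half of
    it.\<close>
  define \<epsilon> where "\<epsilon> = \<delta> / (16 * 2 ^ m)"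
  have "\<epsilon> > 0" using \<delta> by (simp add: \<epsilon>_def)
  obtain N where N: "\<And>m. m \<ge> N \<Longrightarrow> \<exists>D. martingale D \<and> bounded_fun D \<and> D [] \<le> \<epsilon> \<and>
      (\<forall>\<sigma>. m \<le> length \<sigma> \<longrightarrow> U \<sigma> \<le> U (take m \<sigma>) + D \<sigma>)"
    using small_oscillation[OF U \<open>\<epsilon> > 0\<close>] by blast
  obtain k where k: "(1 / 2) ^ k < \<delta> / 16"
    using real_arch_pow_inv[of "\<delta> / 16" "1 / 2"] \<delta> by auto
  define m1 where "m1 = max N (max m k)"
  have m1: "N \<le> m1" "m \<le> m1" "k \<le> m1" by (auto simp: m1_def)
  have "(1 / 2 :: real) ^ m1 \<le> (1 / 2) ^ k" using m1(3) by (intro power_decreasing) auto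
  then have small: "8 / 2 ^ m1 < \<delta> / 2" using k by (simp add: power_divide)
  obtain D where D: "martingale D" "bounded_fun D" "D [] \<le> \<epsilon>"
    "\<And>\<sigma>. m1 \<le> length \<sigma> \<Longrightarrow> U \<sigma> \<le> U (take m1 \<sigma>) + D \<sigma>"
    using N[OF m1(1)] by blast
  let ?W = "\<lambda>\<sigma>. U \<sigma> + 4 * D \<sigma> + 8 / 2 ^ m1"
  have W: "martingale ?W"
    unfolding martingale_def
  proof (intro conjI allI)
    fix \<sigma>
    show "0 \<le> ?W \<sigma>" using martingale_nonneg[OF U(1), of \<sigma>] martingale_nonneg[OF D(1), of \<sigma>] by simp
    show "2 * ?W \<sigma> = ?W (\<sigma> @ [False]) + ?W (\<sigma> @ [True])"
      using martingale_step[OF U(1), of \<sigma>] martingale_step[OF D(1), of \<sigma>] by simp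
  qed
  have "?W \<sigma> < S \<sigma>" if "length \<sigma> = m" for \<sigma>
  proof -
    have "D \<sigma> \<le> 2 ^ m * \<epsilon>"
      using martingale_le_root[OF D(1), of \<sigma>] that D(3) by (auto intro: order_trans)
    also have "\<dots> = \<delta> / 16" by (simp add: \<epsilon>_def)
    finally show ?thesis using small \<delta>(2)[OF that] \<delta>(1) by linarith
  qed
  then obtain S1 where "martingale S1" "\<forall>\<sigma>. dyadic (S1 \<sigma>)" "\<forall>\<sigma>. length \<sigma> \<le> m \<longrightarrow> S1 \<sigma> = S \<sigma>"
    "\<forall>\<sigma>. m \<le> length \<sigma> \<longrightarrow> ?W \<sigma> < S1 \<sigma>"
    using dyadic_martingale_above[OF S W] by blast
  then show ?thesis using that[of S1 m1 D] D m1 by auto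
qed

lemma path_value_in:
  assumes "\<forall>\<rho>. \<rho> \<in> T \<longleftrightarrow> (\<forall>n < length \<rho>. \<rho> ! n \<in> B n)" "is_path T f"
  shows "f n \<in> B n"
proof -
  have "map f [0..<Suc n] \<in> T" using assms(2) unfolding is_path_def by blast
  then have "\<forall>k < length (map f [0..<Suc n]). map f [0..<Suc n] ! k \<in> B k" using assms(1) by blast
  then have "map f [0..<Suc n] ! n \<in> B n" by simp
  then show ?thesis by (simp del: upt_Suc)
qed

text \<open>The conclusion quantifies over every martingale \<open>R\<close> compatible with the new
  condition, so it survives all later refinements.\<close>

lemma force_program:
  assumes cond: "is_cond S m U"
    and T: "homogeneous_tree T" "\<not> (\<exists>f. is_path T f \<and> computable f)"
  shows "\<exists>S' m' U'. is_cond S' m' U' \<and> refines S' m' U' S m U \<and>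
    (\<forall>R f. martingale R \<and> (\<forall>\<sigma>. dyadic (R \<sigma>)) \<and> (\<forall>\<sigma>. length \<sigma> \<le> m' \<longrightarrow> R \<sigma> = S' \<sigma>) \<and>
      (\<forall>\<sigma>. U' \<sigma> \<le> R \<sigma>) \<and> is_path T f \<longrightarrow>
      \<not> (\<forall>n. eval (mart_oracle R) e [n] (if f n then 1 else 0)))"
proof -
  obtain Bs where Bs: "\<forall>\<rho>. \<rho> \<in> T \<longleftrightarrow> (\<forall>n < length \<rho>. \<rho> ! n \<in> Bs n)"
    using T(1) by (auto simp: homogeneous_tree_def)
  have U: "martingale U" "bounded_fun U" using cond by (auto simp: is_cond_def)
  obtain S1 m1 D where S1: "martingale S1" "\<And>\<sigma>. dyadic (S1 \<sigma>)" "m \<le> m1" "\<And>\<sigma>. length \<sigma> \<le> m \<Longrightarrow> S1 \<sigma> = S \<sigma>"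
    and D: "martingale D" "bounded_fun D" "\<And>\<sigma>. m1 \<le> length \<sigma> \<Longrightarrow> U \<sigma> \<le> U (take m1 \<sigma>) + D \<sigma>"
    and gap: "\<And>\<rho>. length \<rho> = m1 \<Longrightarrow> U \<rho> + 4 * D \<rho> + 8 / 2 ^ m1 < S1 \<rho>"
    using split_condition[OF cond] by metis
  define v where "v = grid D"
  define d where "d = (\<lambda>j. if j < 2 * 2 ^ m1 then v j else 0)"
  obtain B where valid: "\<And>s. valid_table m1 d B v s"
    using valid_table_grid[OF D(1,2)] unfolding d_def v_def by blast
  obtain q where q: "\<forall>p \<ge> q. \<forall>\<sigma> \<in> {\<sigma>. length \<sigma> \<le> m1}. \<exists>n :: nat. S1 \<sigma> = real n / 2 ^ p"
    using dyadic_scale_finite[OF finite_strings_le, of m1 S1] S1(2) by blast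
  \<comment> \<open>The additional \<open>2 * m1\<close> makes \<open>4 * v j / 4 ^ m1\<close> a
    multiple of \<open>1 / 2 ^ p\<close>.\<close>
  define p where "p = q + 2 * m1"
  have "\<forall>\<sigma>. \<exists>n :: nat. length \<sigma> \<le> m1 \<longrightarrow> S1 \<sigma> = real n / 2 ^ p"
    using q unfolding p_def by (metis le_add1 mem_Collect_eq)
  then obtain g :: "bool list \<Rightarrow> nat" where g: "\<And>\<sigma>. length \<sigma> \<le> m1 \<Longrightarrow> S1 \<sigma> = real (g \<sigma>) / 2 ^ p"
    by metis
  define a where "a = (\<lambda>j. if j < 2 * 2 ^ m1 then g (str j) else 0)"
  \<comment> \<open>The numerators of \<open>r\<close> below. On level \<open>m1\<close> the
    subtraction does not truncate, because \<open>r\<close> is nonnegative there; the cutoff gives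
    finite support.\<close>
  define c where "c = (\<lambda>j. if j < 2 * 2 ^ m1 then g (str j) - 4 * v j * 2 ^ q else 0)"
  define r where "r \<rho> = S1 \<rho> - 4 * real (v (idx \<rho>)) / 4 ^ m1" for \<rho>
  have a: "S1 \<sigma> = real (a (idx \<sigma>)) / 2 ^ p" if "length \<sigma> \<le> m1" for \<sigma>
    using g[OF that] that by (simp add: a_def length_le_iff_idx)
  have vD: "D \<sigma> + 1 / 2 ^ length \<sigma> \<le> real (v (idx \<sigma>)) / 4 ^ length \<sigma>"
    "real (v (idx \<sigma>)) / 4 ^ length \<sigma> \<le> D \<sigma> + 2 / 2 ^ length \<sigma>" for \<sigma>
  proof -
    define x :: real where "x = 2 ^ length \<sigma>"
    have x: "1 \<le> x" "4 ^ length \<sigma> = x * x" by (simp_all add: x_def four_power)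
    have "x * x * D \<sigma> + x \<le> real (v (idx \<sigma>))" "real (v (idx \<sigma>)) \<le> x * x * D \<sigma> + x + 1"
      using grid_bounds[OF D(1), of \<sigma>] by (simp_all add: v_def x x_def[symmetric])
    then have "x * x * D \<sigma> + x \<le> real (v (idx \<sigma>))" "real (v (idx \<sigma>)) \<le> x * x * D \<sigma> + 2 * x"
      using x(1) by linarith+
    then have "(x * x * D \<sigma> + x) / (x * x) \<le> real (v (idx \<sigma>)) / (x * x)"
      "real (v (idx \<sigma>)) / (x * x) \<le> (x * x * D \<sigma> + 2 * x) / (x * x)"
      using x(1) by (auto intro!: divide_right_mono)
    then show "D \<sigma> + 1 / 2 ^ length \<sigma> \<le> real (v (idx \<sigma>)) / 4 ^ length \<sigma>"
      "real (v (idx \<sigma>)) / 4 ^ length \<sigma> \<le> D \<sigma> + 2 / 2 ^ length \<sigma>"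
      using x(1) unfolding x(2) x_def[symmetric] by (simp_all add: add_divide_distrib)
  qed
  \<comment> \<open>The reserved four copies cost at most \<open>4 * D \<rho> + 8 / 2 ^ m1\<close>,
    exactly what \<open>gap\<close> provides.\<close>
  have Ur: "U \<rho> \<le> r \<rho>" if "length \<rho> = m1" for \<rho>
    using gap[OF that] vD(2)[of \<rho>] that by (simp add: r_def)
  have r: "real (c (idx \<rho>)) / 2 ^ p = r \<rho>" if "length \<rho> = m1" for \<rho>
  proof -
    have pw: "(2::real) ^ p = 2 ^ q * 4 ^ m1" by (simp add: p_def power_add power_mult)
    have rg: "r \<rho> = (real (g \<rho>) - real (4 * v (idx \<rho>) * 2 ^ q)) / 2 ^ p"
      using g[of \<rho>] that by (simp add: r_def diff_divide_distrib pw)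
    have "0 \<le> r \<rho>" using Ur[OF that] martingale_nonneg[OF U(1), of \<rho>] by linarith
    then have "0 \<le> r \<rho> * 2 ^ p" by simp
    then have "0 \<le> real (g \<rho>) - real (4 * v (idx \<rho>) * 2 ^ q)"
      unfolding rg by (simp del: of_nat_mult)
    then have "4 * v (idx \<rho>) * 2 ^ q \<le> g \<rho>" by (simp only: diff_ge_0_iff_ge of_nat_le_iff)
    moreover have "c (idx \<rho>) = g \<rho> - 4 * v (idx \<rho>) * 2 ^ q"
      using length_le_iff_idx[of \<rho> m1] that by (simp add: c_def)
    ultimately show ?thesis unfolding rg by (simp only: of_nat_diff)
  qed
  have comp_fun: "comp_fun k F \<Longrightarrow> comp_fun k (\<lambda>v. d (F v))" "comp_fun k F \<Longrightarrow> comp_fun k (\<lambda>v. a (F v))"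
    "comp_fun k F \<Longrightarrow> comp_fun k (\<lambda>v. c (F v))" for k F
    unfolding d_def a_def c_def by (rule comp_fun_finite_support; assumption)+
  define C where "C i s n \<longleftrightarrow> covered e m1 p d a c B i s n" for i s n
  have decC: "decidable 2 (\<lambda>v. C i (v 0) (v 1))" for i
    unfolding C_def by (rule decidable_covered) (rule comp_fun; assumption)+
  consider (wrong) n i s where "C i s n" "i = 0 \<or> i = 1" "(i = 1) \<notin> Bs n"
    | (total) "\<And>n. \<exists>s. C 0 s n \<or> C 1 s n" "\<And>n i s. C i s n \<Longrightarrow> i = 0 \<or> i = 1 \<Longrightarrow> (i = 1) \<in> Bs n"
    | (partial) n where "\<And>s. \<not> C 0 s n" "\<And>s. \<not> C 1 s n"
    by blast
  then show ?thesis
  proof cases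
    case wrong
    obtain P K b t u where dom: "dominates m1 p a c P K (digit b t) v"
      and sim: "sim e (table_oracle (p + P) K b t) u [n] = Suc i"
      using covered_imp_dominates[of e m1 p d a c B i s n v] wrong(1) valid unfolding C_def by blast
    obtain S' where S': "martingale S'" "\<And>\<sigma>. dyadic (S' \<sigma>)" "m1 \<le> K"
      "\<And>\<sigma>. length \<sigma> \<le> K \<Longrightarrow> S' \<sigma> = real (digit b t (idx \<sigma>)) / 2 ^ (p + P)"
      "\<And>\<sigma>. length \<sigma> \<le> m1 \<Longrightarrow> S' \<sigma> = real (a (idx \<sigma>)) / 2 ^ p"
      "\<And>\<sigma>. m1 \<le> length \<sigma> \<Longrightarrow> length \<sigma> \<le> K \<Longrightarrow>
        real (c (idx (take m1 \<sigma>))) / 2 ^ p + real (v (idx \<sigma>)) / 4 ^ length \<sigma> \<le> S' \<sigma>"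
      using dominatesE[OF dom] by metis
    \<comment> \<open>\<open>U\<close> is at most \<open>r (take m1 \<sigma>) + D \<sigma>\<close>,
      and the table exceeds \<open>D\<close> by at least \<open>1 / 2 ^ length \<sigma>\<close>,
      which gives strictness. Freezing \<open>S'\<close> up to \<open>K\<close> preserves the
      simulated computation.\<close>
    have "U \<sigma> < S' \<sigma>" if "length \<sigma> = K" for \<sigma>
    proof -
      have "r (take m1 \<sigma>) + real (v (idx \<sigma>)) / 4 ^ length \<sigma> \<le> S' \<sigma>"
        using S'(6)[of \<sigma>] r[of "take m1 \<sigma>"] that S'(3) by simp
      moreover have "U \<sigma> \<le> r (take m1 \<sigma>) + D \<sigma>"
        using D(3)[of \<sigma>] Ur[of "take m1 \<sigma>"] that S'(3) by simp
      moreover have "(0::real) < 1 / 2 ^ length \<sigma>" by simp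
      ultimately show ?thesis using vD(1)[of \<sigma>] by linarith
    qed
    then have "is_cond S' K U" using S' U by (simp add: is_cond_def)
    moreover have "refines S' K U S m U"
      using S1(3,4) S'(3,5) a by (simp add: refines_def)
    moreover have "\<not> (\<forall>n. eval (mart_oracle R) e [n] (if f n then 1 else 0))"
      if R: "\<forall>\<sigma>. length \<sigma> \<le> K \<longrightarrow> R \<sigma> = S' \<sigma>" and f: "is_path T f" for R f
    proof
      assume "\<forall>n. eval (mart_oracle R) e [n] (if f n then 1 else 0)"
      then have ev: "eval (mart_oracle R) e [n] (if f n then 1 else 0)" by blast
      have or: "table_oracle (p + P) K b t x =
          (if length (list_decode (fst (prod_decode x))) \<le> K then Suc (mart_oracle R x) else 0)" for x
        by (rule table_oracle_eq) (use R S'(4) in simp)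
      have "eval (mart_oracle R) e [n] i"
        by (rule sim_sound[OF _ sim]) (simp add: or split: if_splits)
      with ev have "(if f n then 1 else 0) = i" by (rule eval_deterministic)
      then have "f n = (i = 1)" by (auto split: if_splits)
      then show False using path_value_in[OF Bs f, of n] wrong(3) by simp
    qed
    ultimately show ?thesis by blast
  next
    case total
    define f where "f n = C 1 (LEAST s. C 0 s n \<or> C 1 s n) n" for n
    have "computable f"
      using computable_selection[of C, OF decC total(1)] by (simp add: f_def[abs_def])
    \<comment> \<open>Homogeneity enters here: each bit only has to be allowed at its own position,
      so independently chosen answers form a path.\<close>
    moreover have "f n \<in> Bs n" for n
    proof -
      have "C 0 (LEAST s. C 0 s n \<or> C 1 s n) n \<or> C 1 (LEAST s. C 0 s n \<or> C 1 s n) n"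
        using LeastI_ex[OF total(1)[of n]] .
      then show ?thesis
        using total(2)[of 1 _ n] total(2)[of 0 _ n] by (cases "f n") (auto simp: f_def)
    qed
    then have "is_path T f" using Bs by (simp add: is_path_def)
    ultimately show ?thesis using T(2) by blast
  next
    case partial
    obtain v0 where v0: "\<And>s. valid_table m1 d B v0 s" "avoids e m1 p a c 0 n v0"
      using uncovered_imp_avoids[of e m1 p d a c B 0 n] partial(1) unfolding C_def by blast
    obtain v1 where v1: "\<And>s. valid_table m1 d B v1 s" "avoids e m1 p a c 1 n v1"
      using uncovered_imp_avoids[of e m1 p d a c B 1 n] partial(2) unfolding C_def by blast
    obtain M0 where M0: "martingale M0" "bounded_fun M0"
      "\<And>\<sigma>. m1 \<le> length \<sigma> \<Longrightarrow> real (v0 (idx \<sigma>)) / 4 ^ length \<sigma> \<le> M0 \<sigma>"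
      "\<And>\<sigma>. length \<sigma> = m1 \<Longrightarrow> M0 \<sigma> \<le> real (d (idx \<sigma>)) / 4 ^ m1"
      using valid_table_majorant[OF v0(1)] by blast
    obtain M1 where M1: "martingale M1" "bounded_fun M1"
      "\<And>\<sigma>. m1 \<le> length \<sigma> \<Longrightarrow> real (v1 (idx \<sigma>)) / 4 ^ length \<sigma> \<le> M1 \<sigma>"
      "\<And>\<sigma>. length \<sigma> = m1 \<Longrightarrow> M1 \<sigma> \<le> real (d (idx \<sigma>)) / 4 ^ m1"
      using valid_table_majorant[OF v1(1)] by blast
    have r_nonneg: "0 \<le> r \<rho>" if "length \<rho> = m1" for \<rho>
      using Ur[OF that] martingale_nonneg[OF U(1), of \<rho>] by linarith
    \<comment> \<open>The part of the new lower bound that is constant above each node of level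
      \<open>m1\<close>; it supplies the summand coded by \<open>c\<close>.\<close>
    define Rc where "Rc = extend_down m1 (\<lambda>\<sigma>. r (take m1 \<sigma>))"
    have Rc_eq: "Rc \<sigma> = r (take m1 \<sigma>)" if "m1 \<le> length \<sigma>" for \<sigma>
      using that by (simp add: Rc_def extend_down_eq)
    have Rc: "martingale Rc"
      unfolding Rc_def by (rule martingale_extend_down) (auto intro: r_nonneg)
    have "r (take m1 \<sigma>) \<le> 2 ^ m1 * S1 []" if "m1 \<le> length \<sigma>" for \<sigma>
    proof -
      have "r (take m1 \<sigma>) \<le> S1 (take m1 \<sigma>)" by (simp add: r_def)
      also have "\<dots> \<le> 2 ^ m1 * S1 []" using martingale_le_root[OF S1(1), of "take m1 \<sigma>"] that by simp
      finally show ?thesis .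
    qed
    then have "bounded_fun Rc"
      unfolding Rc_def by (intro bounded_martingaleI[OF Rc[unfolded Rc_def]] extend_down_le)
    define U' where "U' = (\<lambda>\<sigma>. Rc \<sigma> + D \<sigma> + M0 \<sigma> + M1 \<sigma>)"
    have U': "martingale U'" "bounded_fun U'"
      unfolding U'_def using Rc \<open>bounded_fun Rc\<close> D M0 M1 by (intro martingale_add bounded_fun_add; simp)+
    \<comment> \<open>Four copies of \<open>x\<close> were reserved, and \<open>D\<close>,
      \<open>M0\<close> and \<open>M1\<close> use at most one each, \<open>D\<close> even less by
      \<open>1 / 2 ^ m1\<close>.\<close>
    have "U' \<rho> < S1 \<rho>" if "length \<rho> = m1" for \<rho>
    proof -
      define x where "x = real (v (idx \<rho>)) / 4 ^ m1"
      have "d (idx \<rho>) = v (idx \<rho>)" using length_le_iff_idx[of \<rho> m1] that by (simp add: d_def)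
      then have "M0 \<rho> \<le> x" "M1 \<rho> \<le> x" using M0(4)[OF that] M1(4)[OF that] by (simp_all add: x_def)
      moreover have "D \<rho> + 1 / 2 ^ m1 \<le> x" using vD(1)[of \<rho>] that by (simp add: x_def)
      moreover have "Rc \<rho> = S1 \<rho> - 4 * x" using Rc_eq[of \<rho>] that by (simp add: r_def x_def)
      moreover have "(0::real) < 1 / 2 ^ m1" "0 \<le> x" by (simp_all add: x_def)
      ultimately show ?thesis unfolding U'_def by linarith
    qed
    then have "is_cond S1 m1 U'" using S1 U' by (simp add: is_cond_def)
    moreover have "U \<sigma> \<le> U' \<sigma>" if "m1 \<le> length \<sigma>" for \<sigma>
      using D(3)[OF that] Ur[of "take m1 \<sigma>"] Rc_eq[OF that] that
        martingale_nonneg[OF M0(1), of \<sigma>] martingale_nonneg[OF M1(1), of \<sigma>]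
      by (simp add: U'_def)
    then have "refines S1 m1 U' S m U" using S1 by (simp add: refines_def)
    moreover have "\<not> (\<forall>n. eval (mart_oracle R) e [n] (if f n then 1 else 0))"
      if R: "martingale R" "\<And>\<sigma>. dyadic (R \<sigma>)" "\<And>\<sigma>. length \<sigma> \<le> m1 \<Longrightarrow> R \<sigma> = S1 \<sigma>" "\<And>\<sigma>. U' \<sigma> \<le> R \<sigma>" for R f
    proof -
      have aR: "R \<sigma> = real (a (idx \<sigma>)) / 2 ^ p" if "length \<sigma> \<le> m1" for \<sigma>
        using a R(3) that by simp
      \<comment> \<open>The remaining summands of \<open>U'\<close> are nonnegative, so
        \<open>R\<close> lies above each counterexample separately and \<open>e\<close> can output
        neither bit at \<open>n\<close>.\<close>
      have "real (c (idx (take m1 \<sigma>))) / 2 ^ p + real (v0 (idx \<sigma>)) / 4 ^ length \<sigma> \<le> R \<sigma>"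
        "real (c (idx (take m1 \<sigma>))) / 2 ^ p + real (v1 (idx \<sigma>)) / 4 ^ length \<sigma> \<le> R \<sigma>"
        if "m1 \<le> length \<sigma>" for \<sigma>
        using R(4)[of \<sigma>] r[of "take m1 \<sigma>"] M0(3)[OF that] M1(3)[OF that] Rc_eq[OF that] that
          martingale_nonneg[OF D(1), of \<sigma>] martingale_nonneg[OF M0(1), of \<sigma>] martingale_nonneg[OF M1(1), of \<sigma>]
        by (simp_all add: U'_def)
      then have "\<not> eval (mart_oracle R) e [n] 0" "\<not> eval (mart_oracle R) e [n] 1"
        using avoids_imp_not_eval[OF R(1,2) aR _ v0(2)] avoids_imp_not_eval[OF R(1,2) aR _ v1(2)] by auto
      then show ?thesis by metis
    qed
    ultimately show ?thesis by blast
  qed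
qed

lemma force_majorant:
  assumes cond: "is_cond S m U" and M: "\<And>n. martingale (M n)" "\<And>n. bounded_fun (M n)"
    and lim: "(\<lambda>n. M n []) \<longlonglongrightarrow> 0"
  shows "\<exists>S' m' U' n. is_cond S' m' U' \<and> refines S' m' U' S m U \<and> m < m' \<and> N \<le> n \<and>
    (\<forall>\<sigma>. M n \<sigma> \<le> U' \<sigma>)"
proof -
  have S: "martingale S" "\<And>\<sigma>. dyadic (S \<sigma>)" and U: "martingale U" "bounded_fun U"
    and less: "\<And>\<sigma>. length \<sigma> = m \<Longrightarrow> U \<sigma> < S \<sigma>"
    using cond by (auto simp: is_cond_def)
  obtain \<delta> where \<delta>: "\<delta> > 0" "\<And>\<sigma>. length \<sigma> = m \<Longrightarrow> U \<sigma> + \<delta> \<le> S \<sigma>"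
    using uniform_gap[of m U S] less by blast
  have "\<exists>n0. \<forall>n \<ge> n0. norm (M n [] - 0) < \<delta> / 2 ^ m"
    using \<delta>(1) by (intro LIMSEQ_D[OF lim]) simp
  then obtain n0 where n0: "\<And>n. n \<ge> n0 \<Longrightarrow> \<bar>M n []\<bar> < \<delta> / 2 ^ m" by auto
  define n where "n = max N n0"
  have n: "M n [] < \<delta> / 2 ^ m" using n0[of n] by (simp add: n_def)
  let ?U = "\<lambda>\<sigma>. U \<sigma> + M n \<sigma>"
  have U': "martingale ?U" "bounded_fun ?U" using U M by (auto intro: martingale_add bounded_fun_add)
  have "?U \<sigma> < S \<sigma>" if "length \<sigma> = m" for \<sigma>
  proof -
    have "M n \<sigma> \<le> 2 ^ m * M n []" using martingale_le_root[OF M(1), of n \<sigma>] that by simp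
    also have "\<dots> < \<delta>" using n by (simp add: field_simps)
    finally show ?thesis using \<delta>(2)[OF that] by simp
  qed
  then obtain S' where "martingale S'" "\<forall>\<sigma>. dyadic (S' \<sigma>)" "\<forall>\<sigma>. length \<sigma> \<le> m \<longrightarrow> S' \<sigma> = S \<sigma>"
    "\<forall>\<sigma>. m \<le> length \<sigma> \<longrightarrow> ?U \<sigma> < S' \<sigma>"
    using dyadic_martingale_above[OF S U'(1)] by blast
  then have "is_cond S' (Suc m) ?U" "refines S' (Suc m) ?U S m U"
    using U' martingale_nonneg[OF M(1)] by (auto simp: is_cond_def refines_def)
  moreover have "M n \<sigma> \<le> ?U \<sigma>" for \<sigma> using martingale_nonneg[OF U(1)] by simp
  moreover have "N \<le> n" by (simp add: n_def)
  ultimately show ?thesis by (intro exI[of _ S'] exI[of _ "Suc m"] exI[of _ ?U] exI[of _ n]) auto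
qed

section \<open>Construction of the generic martingale\<close>

instance recf :: countable
  by countable_datatype

theorem theorem3p1:
  fixes Sbar :: "nat \<Rightarrow> bool list \<Rightarrow> real"
    and T :: "bool list set"
  assumes "\<And>n. martingale (Sbar n)"
    and "\<And>n. bounded_fun (Sbar n)"
    and "(\<lambda>n. Sbar n []) \<longlonglongrightarrow> 0"
    and "homogeneous_tree T"
    and "\<not> (\<exists>f. is_path T f \<and> computable f)"
  shows "\<exists>S. martingale S \<and> infinite {n. \<forall>\<rho>. S \<rho> \<ge> Sbar n \<rho>} \<and> \<not> computes_path S T"
proof -
  define forces where "forces e S m U \<longleftrightarrow> (\<forall>R f. martingale R \<and> (\<forall>\<sigma>. dyadic (R \<sigma>)) \<and>
      (\<forall>\<sigma>. length \<sigma> \<le> m \<longrightarrow> R \<sigma> = S \<sigma>) \<and> (\<forall>\<sigma>. U \<sigma> \<le> R \<sigma>) \<and> is_path T f \<longrightarrow>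
      \<not> (\<forall>n. eval (mart_oracle R) e [n] (if f n then 1 else 0)))"
    for e and S :: "bool list \<Rightarrow> real" and m :: nat and U
  \<comment> \<open>Stage \<open>t\<close> first absorbs some \<open>Sbar n\<close> with
    \<open>n \<ge> t\<close> and then defeats program number \<open>t\<close>.\<close>
  define step where "step t = (\<lambda>(S, m, U) (S', m', U'). refines S' m' U' S m U \<and> m < m' \<and>
      (\<exists>n \<ge> t. \<forall>\<sigma>. m' \<le> length \<sigma> \<longrightarrow> Sbar n \<sigma> \<le> U' \<sigma>) \<and> forces (from_nat t) S' m' U')" for t
  define ok where "ok = (\<lambda>(S, m, U). is_cond S m U)"
  have "\<exists>X. \<forall>t. ok (X t) \<and> step t (X t) (X (Suc t))"
  proof (rule dependent_nat_choice)
    have "dyadic 1" unfolding dyadic_def by (intro exI[of _ 0] exI[of _ 1]) simp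
    \<comment> \<open>Start with the constant 1, strictly above the zero martingale at the
      root.\<close>
    then show "\<exists>x. ok x"
      by (intro exI[of _ "(\<lambda>_. 1, 0, \<lambda>_. 0)"]) (auto simp: ok_def is_cond_def martingale_def bounded_fun_def)
  next
    fix x t assume "ok x"
    then obtain S m U where x: "x = (S, m, U)" and cond: "is_cond S m U" by (cases x) (auto simp: ok_def)
    obtain S1 m1 U1 n where 1: "is_cond S1 m1 U1" "refines S1 m1 U1 S m U" "m < m1" "t \<le> n" "\<forall>\<sigma>. Sbar n \<sigma> \<le> U1 \<sigma>"
      using force_majorant[of S m U Sbar t, OF cond assms(1-3)] by blast
    have "\<exists>S' m' U'. is_cond S' m' U' \<and> refines S' m' U' S1 m1 U1 \<and> forces (from_nat t) S' m' U'"
      unfolding forces_def by (rule force_program[OF 1(1) assms(4,5)])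
    then obtain S2 m2 U2 where 2: "is_cond S2 m2 U2" "refines S2 m2 U2 S1 m1 U1" "forces (from_nat t) S2 m2 U2"
      by blast
    have "Sbar n \<sigma> \<le> U2 \<sigma>" if "m2 \<le> length \<sigma>" for \<sigma>
    proof -
      have "Sbar n \<sigma> \<le> U1 \<sigma>" using 1(5) by blast
      also have "\<dots> \<le> U2 \<sigma>" using 2(2) that by (simp add: refines_def)
      finally show ?thesis .
    qed
    moreover have "m < m2" using 1(3) 2(2) by (simp add: refines_def)
    moreover note refines_trans[OF 2(2) 1(2)]
    ultimately show "\<exists>y. ok y \<and> step t x y"
      using 1(4) 2(1,3) by (intro exI[of _ "(S2, m2, U2)"]) (auto simp: ok_def step_def x)
  qed
  then obtain X where X: "\<And>t. ok (X t)" "\<And>t. step t (X t) (X (Suc t))" by blast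
  define S where "S t = fst (X t)" for t
  define m where "m t = fst (snd (X t))" for t
  define U where "U t = snd (snd (X t))" for t
  have cond: "is_cond (S t) (m t) (U t)" for t
    using X(1)[of t] by (simp add: ok_def S_def m_def U_def split_beta)
  have refines: "refines (S (Suc t)) (m (Suc t)) (U (Suc t)) (S t) (m t) (U t)"
    and m_less: "m t < m (Suc t)"
    and Sbar_le: "\<exists>n \<ge> t. \<forall>\<sigma>. m (Suc t) \<le> length \<sigma> \<longrightarrow> Sbar n \<sigma> \<le> U (Suc t) \<sigma>"
    and forced: "forces (from_nat t) (S (Suc t)) (m (Suc t)) (U (Suc t))" for t
    using X(2)[of t] by (auto simp: step_def S_def m_def U_def split_beta)
  have S_mart: "martingale (S t)" "dyadic (S t \<sigma>)" and U_mart: "martingale (U t)" for t \<sigma>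
    using cond[of t] by (auto simp: is_cond_def)
  have m_mono: "m t \<le> m t'" if "t \<le> t'" for t t'
    using m_less that by (meson less_imp_le lift_Suc_mono_le)
  have m_ge: "t \<le> m t" for t
  proof (induction t)
    case (Suc t)
    then show ?case using m_less[of t] by simp
  qed simp
  have S_stable: "S (t + k) \<sigma> = S t \<sigma>" if "length \<sigma> \<le> m t" for t k \<sigma>
  proof (induction k)
    case (Suc k)
    have "length \<sigma> \<le> m (t + k)" using that m_mono[of t "t + k"] by simp
    then show ?case using refines[of "t + k"] Suc by (simp add: refines_def)
  qed simp
  have U_mono: "U t \<sigma> \<le> U (t + k) \<sigma>" if "m (t + k) \<le> length \<sigma>" for t k \<sigma>
    using that
  proof (induction k)
    case (Suc k)
    then have "U t \<sigma> \<le> U (t + k) \<sigma>" using m_less[of "t + k"] by simp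
    also have "\<dots> \<le> U (t + Suc k) \<sigma>" using refines[of "t + k"] Suc.prems by (simp add: refines_def)
    finally show ?case .
  qed simp
  \<comment> \<open>Since \<open>t \<le> m t\<close>, a string is frozen from the stage numbered by
    its length on.\<close>
  define R where "R \<sigma> = S (length \<sigma>) \<sigma>" for \<sigma>
  have R_eq: "R \<sigma> = S t \<sigma>" if "length \<sigma> \<le> m t" for t \<sigma>
  proof (cases "t \<le> length \<sigma>")
    case True
    then show ?thesis using S_stable[OF that, of "length \<sigma> - t"] by (simp add: R_def)
  next
    case False
    then show ?thesis using S_stable[of \<sigma> "length \<sigma>" "t - length \<sigma>"] m_ge by (simp add: R_def)
  qed
  have R: "martingale R"
    unfolding martingale_def
  proof (intro conjI allI)
    fix \<sigma>
    show "0 \<le> R \<sigma>" unfolding R_def by (rule martingale_nonneg[OF S_mart(1)])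
    \<comment> \<open>At this stage \<sigma> and both its children are frozen.\<close>
    define t where "t = Suc (length \<sigma>)"
    have "R \<sigma> = S t \<sigma>" "R (\<sigma> @ [b]) = S t (\<sigma> @ [b])" for b
      using m_ge[of t] by (auto intro!: R_eq simp: t_def)
    then show "2 * R \<sigma> = R (\<sigma> @ [False]) + R (\<sigma> @ [True])"
      using S_mart(1)[of t] by (simp add: martingale_def)
  qed
  have R_dyadic: "dyadic (R \<sigma>)" for \<sigma> unfolding R_def by (rule S_mart(2))
  have U_le: "U t \<sigma> \<le> R \<sigma>" for t \<sigma>
  proof (rule martingale_le_below[OF U_mart R])
    fix \<tau> :: "bool list" assume len: "length \<tau> = m (t + length \<sigma>)"
    have "U t \<tau> \<le> U (t + length \<sigma>) \<tau>" using len by (intro U_mono) simp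
    also have "\<dots> < S (t + length \<sigma>) \<tau>" using cond[of "t + length \<sigma>"] len by (simp add: is_cond_def)
    also have "\<dots> = R \<tau>" using R_eq[of \<tau> "t + length \<sigma>"] len by simp
    finally show "U t \<tau> \<le> R \<tau>" by simp
  next
    show "length \<sigma> \<le> m (t + length \<sigma>)" using m_ge[of "t + length \<sigma>"] by simp
  qed
  have "\<exists>n \<ge> t. \<forall>\<rho>. Sbar n \<rho> \<le> R \<rho>" for t
  proof -
    obtain n where n: "n \<ge> t" "\<And>\<sigma>. m (Suc t) \<le> length \<sigma> \<Longrightarrow> Sbar n \<sigma> \<le> U (Suc t) \<sigma>"
      using Sbar_le by blast
    then have above: "Sbar n \<sigma> \<le> R \<sigma>" if "m (Suc t) \<le> length \<sigma>" for \<sigma>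
      using that U_le order_trans by blast
    have "Sbar n \<sigma> \<le> R \<sigma>" for \<sigma>
    proof (cases "m (Suc t) \<le> length \<sigma>")
      case False
      show ?thesis
        by (rule martingale_le_below[OF assms(1) R, of "m (Suc t)"]) (use False above in auto)
    qed (rule above)
    then show ?thesis using n(1) by blast
  qed
  then have "infinite {n. \<forall>\<rho>. R \<rho> \<ge> Sbar n \<rho>}"
    unfolding finite_nat_set_iff_bounded by (auto simp: not_less)
  moreover have "\<not> computes_path R T"
  proof
    assume "computes_path R T"
    then obtain f e where fe: "is_path T f" "\<forall>n. eval (mart_oracle R) e [n] (if f n then 1 else 0)"
      unfolding computes_path_def computable_in_def by blast
    \<comment> \<open>Program \<open>e\<close> is dealt with at stage \<open>to_nat e\<close>, and
      \<open>R\<close> is compatible with the condition reached there.\<close>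
    have "forces e (S (Suc (to_nat e))) (m (Suc (to_nat e))) (U (Suc (to_nat e)))"
      using forced[of "to_nat e"] by simp
    then show False
      using fe R R_dyadic R_eq U_le unfolding forces_def by blast
  qed
  ultimately show ?thesis using R by blast
qed

end
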